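(* Let $B\cong\bigoplus_{a=1}^d M_{n_a}(\mathbb{C})$ and let $\mathcal{G}=(B,\psi,A)$ be a finite quantum graph such that $\psi$ is a $\delta$-form and $A$ is completely positive. Let $\mathcal{C}$ be a unital $C^*$-algebra, let $S:B\to\mathcal{C}$ be any local quantum Cuntz--Krieger $\mathcal{G}$-family, and write $S^{(a)}_{ij}:=S(f^{(a)}_{ij})$, where $f^{(a)}_{ij}$ are the adapted matrix units of $(B,\psi)$. Then for all $1\le a,b\le d$, $1\le i,j\le n_a$ and $1\le k,\ell\le n_b$: 1. if $(S^{(a)}_{ij})^*S^{(b)}_{k\ell}\neq 0$, then $a=b$ and $i=k$; 2. if $S^{(a)}_{ij}S^{(b)}_{k\ell}\neq 0$, then $f^{(a)}_{ij}\cdot\epsilon_{\mathcal{G}}\cdot f^{(b)}_{k\ell}\neq 0$ in $B\otimes B$; 3. if $S^{(a)}_{ij}(S^{(b)}_{k\ell})^*\neq 0$, then there exists $1\le q\le n_b$ such that $f^{(a)}_{ij}\cdot\epsilon_{\mathcal{G}}\cdot A(f^{(b)}_{\ell q})\neq 0$ in $B\otimes B$.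
   Context: Let $B=\bigoplus_{a=1}^d M_{n_a}(\mathbb{C})$ be a finite-dimensional $C^*$-algebra with a state $\psi$, and write $\psi(x)=\sum_a \mathrm{Tr}_a(\rho^{(a)}x^{(a)})$ with density matrix $\rho=\bigoplus_a\rho^{(a)}$ ($\mathrm{Tr}_a$ is the non-normalized trace on $M_{n_a}$). For $\delta>0$, $\psi$ is a $\delta$-form if $\rho$ is invertible and $\mathrm{Tr}_a((\rho^{(a)})^{-1})=\delta^2$ for every $a$. Matrix units $e^{(a)}_{ij}$ of $B$ are chosen so that each $\rho^{(a)}$ is diagonal, and the adapted matrix units are $f^{(a)}_{ij}:=\psi(e^{(a)}_{ii})^{-1/2}\psi(e^{(a)}_{jj})^{-1/2}e^{(a)}_{ij}$. Let $m:B\otimes B\to B$, $m(x\otimes y)=xy$, and let $m^*:B\to B\otimes B$ be its Hilbert space adjoint with respect to the inner products $\langle x,y\rangle=\psi(x^*y)$ on $B$ and the one induced by $\psi\otimes\psi$ on $B\otimes B$. (Then $m^*(f^{(a)}_{ij})=\sum_k f^{(a)}_{ik}\otimes f^{(a)}_{kj}$ and $mm^*=\delta^2\,\mathrm{id}_B$.) A quantum adjacency matrix on $(B,\psi)$ is a linear map $A:B\to B$ with $m(A\otimes A)m^*=\delta^2A$; a finite quantum graph is a triple $(B,\psi,A)$ with $\psi$ a $\delta$-form and $A$ a quantum adjacency matrix. For a unital $C^*$-algebra $\mathcal{C}$ let $\mu:\mathcal{C}\odot\mathcal{C}\to\mathcal{C}$, $\mu(x\otimes y)=xy$. For a linear map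 $S:B\to\mathcal{C}$, let $S^*:B\to\mathcal{C}$ be the linear map $S^*(x):=S(x^* )^*$. The map $S$ is a local quantum Cuntz--Krieger $(B,\psi,A)$-family if (LQCK1) $\mu(\mu\otimes\mathrm{id})(S\otimes S^*\otimes S)(m^*\otimes\mathrm{id})=\delta^{-2}S\,m$ as maps $B\otimes B\to\mathcal{C}$; (LQCK2) $\mu(S^*\otimes S)=\delta^{-2}\mu(S\otimes S^* )m^*A\,m$ as maps $B\otimes B\to\mathcal{C}$; (LQCK3) $\mu(S\otimes S^* )m^*(1_B)=\delta^{-2}1_{\mathcal{C}}$. The quantum edge checker is $\epsilon_{\mathcal{G}}:=\delta^{-2}(\mathrm{id}\otimes A)m^*(1_B)\in B\otimes B$; it is the cyclic generator of the quantum edge correspondence. For $x,y\in B$ and $\xi=\sum_j a_j\otimes b_j\in B\otimes B$, $x\cdot\xi\cdot y:=\sum_j (xa_j)\otimes(b_jy)$. *)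

theory Defs
  imports "HOL-Analysis.Analysis" "HOL-Library.Function_Algebras"
begin

section \<open>Unital C*-algebras\<close>

class complex_vector_space = ab_group_add +
  fixes scaleC :: "complex \<Rightarrow> 'a \<Rightarrow> 'a"  (infixr "*\<^sub>C" 75)
  assumes scaleC_add_right: "c *\<^sub>C (x + y) = c *\<^sub>C x + c *\<^sub>C y"
    and scaleC_add_left: "(b + c) *\<^sub>C x = b *\<^sub>C x + c *\<^sub>C x"
    and scaleC_scaleC: "b *\<^sub>C (c *\<^sub>C x) = (b * c) *\<^sub>C x"
    and scaleC_one: "1 *\<^sub>C x = x"

text \<open>The unit is introduced through \<^class>\<open>monoid_mult\<close> rather than \<^class>\<open>ring_1\<close>, so that the zero
  algebra is not excluded.\<close>

class unital_cstar_algebra = banach + real_normed_algebra + monoid_mult + complex_vector_space +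
  fixes star :: "'a \<Rightarrow> 'a"
  assumes scaleC_of_real: "complex_of_real r *\<^sub>C x = r *\<^sub>R x"
    and norm_scaleC: "norm (c *\<^sub>C x) = cmod c * norm x"
    and scaleC_mult_left: "(c *\<^sub>C x) * y = c *\<^sub>C (x * y)"
    and scaleC_mult_right: "x * (c *\<^sub>C y) = c *\<^sub>C (x * y)"
    and star_star: "star (star x) = x"
    and star_add: "star (x + y) = star x + star y"
    and star_scaleC: "star (c *\<^sub>C x) = cnj c *\<^sub>C star x"
    and star_mult: "star (x * y) = star y * star x"
    and cstar_identity: "norm (star x * x) = (norm x)\<^sup>2"

instantiation complex :: unital_cstar_algebra
begin
definition scaleC_complex :: "complex \<Rightarrow> complex \<Rightarrow> complex" where "scaleC_complex c x = c * x"
definition star_complex :: "complex \<Rightarrow> complex" where "star_complex = cnj"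
instance
  by standard
    (simp_all add: scaleC_complex_def star_complex_def algebra_simps scaleR_conv_of_real
      norm_mult power2_eq_square)
end

instantiation "fun" :: (type, complex_vector_space) complex_vector_space
begin
definition scaleC_fun :: "complex \<Rightarrow> ('a \<Rightarrow> 'b) \<Rightarrow> 'a \<Rightarrow> 'b"
  where "scaleC_fun c f = (\<lambda>x. c *\<^sub>C f x)"
instance
  by standard
    (simp_all add: scaleC_fun_def fun_eq_iff scaleC_add_right scaleC_add_left scaleC_scaleC scaleC_one)
end


section \<open>Coordinate spaces and their tensor products\<close>

text \<open>\<^term>\<open>vecs I\<close> is the space of complex vectors indexed by \<^term>\<open>I\<close>, realised as the functions
  vanishing off \<^term>\<open>I\<close>. The tensor product of \<^term>\<open>vecs I\<close> and \<^term>\<open>vecs J\<close> is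
  \<^term>\<open>vecs (I \<times> J)\<close>. Addition of vectors is the pointwise one; pointwise multiplication of
  functions is never used.\<close>

definition vecs :: "'p set \<Rightarrow> ('p \<Rightarrow> complex) set" where
  "vecs I = {x. \<forall>p. p \<notin> I \<longrightarrow> x p = 0}"

definition basis_vec :: "'p \<Rightarrow> 'p \<Rightarrow> complex" where
  "basis_vec p = (\<lambda>q. if q = p then 1 else 0)"

definition tensor :: "('p \<Rightarrow> complex) \<Rightarrow> ('q \<Rightarrow> complex) \<Rightarrow> 'p \<times> 'q \<Rightarrow> complex"
    (infixr "\<otimes>\<^sub>t" 70) where
  "x \<otimes>\<^sub>t y = (\<lambda>(p, q). x p * y q)"

definition linear_on_vecs :: "'p set \<Rightarrow> (('p \<Rightarrow> complex) \<Rightarrow> 'v::complex_vector_space) \<Rightarrow> bool" where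
  "linear_on_vecs I f \<longleftrightarrow>
     (\<forall>x\<in>vecs I. \<forall>y\<in>vecs I. f (x + y) = f x + f y) \<and>
     (\<forall>c. \<forall>x\<in>vecs I. f (c *\<^sub>C x) = c *\<^sub>C f x)"

text \<open>\<^term>\<open>tensor_lift I J \<beta>\<close> is the linear map on the tensor product induced by a bilinear map
  \<^term>\<open>\<beta>\<close>, that is, the linear map sending \<^term>\<open>x \<otimes>\<^sub>t y\<close> to \<^term>\<open>\<beta> x y\<close>, as confirmed by the lemma
  below.\<close>

definition tensor_lift ::
  "'p set \<Rightarrow> 'q set \<Rightarrow> (('p \<Rightarrow> complex) \<Rightarrow> ('q \<Rightarrow> complex) \<Rightarrow> 'v::complex_vector_space)
     \<Rightarrow> ('p \<times> 'q \<Rightarrow> complex) \<Rightarrow> 'v" where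
  "tensor_lift I J \<beta> \<xi> = (\<Sum>(p, q)\<in>I \<times> J. \<xi> (p, q) *\<^sub>C \<beta> (basis_vec p) (basis_vec q))"

lemma scaleC_zero_left: "0 *\<^sub>C x = (0::'v::complex_vector_space)"
  using scaleC_add_left[of 0 0 x] by simp

lemma scaleC_zero_right: "c *\<^sub>C 0 = (0::'v::complex_vector_space)"
  using scaleC_add_right[of c 0 "0::'v"] by simp

lemma scaleC_sum_right:
  "c *\<^sub>C (\<Sum>i\<in>K. g i) = (\<Sum>i\<in>K. c *\<^sub>C (g i :: 'v::complex_vector_space))"
  by (induction K rule: infinite_finite_induct) (simp_all add: scaleC_zero_right scaleC_add_right)

lemma basis_vec_in_vecs: "p \<in> I \<Longrightarrow> basis_vec p \<in> vecs I"
  by (auto simp: vecs_def basis_vec_def)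

lemma linear_on_vecs_expand:
  assumes fin: "finite I" and lin: "linear_on_vecs I f" and x: "x \<in> vecs I"
  shows "f x = (\<Sum>p\<in>I. x p *\<^sub>C f (basis_vec p))"
proof -
  have f0: "f 0 = 0"
  proof -
    have "0 \<in> vecs I" by (simp add: vecs_def)
    then have "f (0 + 0) = f 0 + f 0" using lin unfolding linear_on_vecs_def by blast
    then show ?thesis by (metis add.right_neutral add_left_cancel)
  qed
  have sum_in: "(\<Sum>p\<in>K. x p *\<^sub>C basis_vec p) \<in> vecs I \<and>
      f (\<Sum>p\<in>K. x p *\<^sub>C basis_vec p) = (\<Sum>p\<in>K. x p *\<^sub>C f (basis_vec p))" if "K \<subseteq> I" for K
    using finite_subset[OF that fin] that
  proof (induction K rule: finite_induct)
    case empty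
    show ?case using f0 by (simp add: vecs_def zero_fun_def)
  next
    case (insert p K)
    have b: "basis_vec p \<in> vecs I" using insert by (intro basis_vec_in_vecs) auto
    then have xb: "x p *\<^sub>C basis_vec p \<in> vecs I"
      by (simp add: vecs_def scaleC_fun_def scaleC_zero_right)
    have IH: "(\<Sum>p\<in>K. x p *\<^sub>C basis_vec p) \<in> vecs I"
      "f (\<Sum>p\<in>K. x p *\<^sub>C basis_vec p) = (\<Sum>p\<in>K. x p *\<^sub>C f (basis_vec p))"
      using insert by auto
    have "x p *\<^sub>C basis_vec p + (\<Sum>p\<in>K. x p *\<^sub>C basis_vec p) \<in> vecs I"
      using xb IH(1) by (simp add: vecs_def)
    moreover have "f (x p *\<^sub>C basis_vec p + (\<Sum>p\<in>K. x p *\<^sub>C basis_vec p)) =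
        x p *\<^sub>C f (basis_vec p) + (\<Sum>p\<in>K. x p *\<^sub>C f (basis_vec p))"
      using lin xb IH b unfolding linear_on_vecs_def by metis
    ultimately show ?case unfolding sum.insert[OF insert.hyps] by blast
  qed
  have ev: "(\<Sum>p\<in>K. g p) q = (\<Sum>p\<in>K. g p q)" for K and g :: "'a \<Rightarrow> 'a \<Rightarrow> complex" and q
    by (induction K rule: infinite_finite_induct) auto
  have "(\<Sum>p\<in>I. x p *\<^sub>C basis_vec p) = x"
  proof
    fix q
    have "(\<Sum>p\<in>I. x p *\<^sub>C basis_vec p) q = (\<Sum>p\<in>I. if q = p then x p else 0)"
      unfolding ev by (intro sum.cong) (auto simp: scaleC_fun_def scaleC_complex_def basis_vec_def)
    also have "\<dots> = x q"
      using fin x by (simp add: vecs_def)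
    finally show "(\<Sum>p\<in>I. x p *\<^sub>C basis_vec p) q = x q" .
  qed
  then show ?thesis using sum_in[of I] by simp
qed

lemma tensor_lift_tensor:
  assumes "finite I" "finite J" "x \<in> vecs I" "y \<in> vecs J"
    and l: "\<And>y. y \<in> vecs J \<Longrightarrow> linear_on_vecs I (\<lambda>x. \<beta> x y)"
    and r: "\<And>x. x \<in> vecs I \<Longrightarrow> linear_on_vecs J (\<beta> x)"
  shows "tensor_lift I J \<beta> (x \<otimes>\<^sub>t y) = \<beta> x y"
proof -
  have "\<beta> x y = (\<Sum>p\<in>I. x p *\<^sub>C \<beta> (basis_vec p) y)"
    using linear_on_vecs_expand[OF assms(1) l[OF assms(4)] assms(3)] .
  also have "\<dots> = (\<Sum>p\<in>I. x p *\<^sub>C (\<Sum>q\<in>J. y q *\<^sub>C \<beta> (basis_vec p) (basis_vec q)))"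
    using linear_on_vecs_expand[OF assms(2) r assms(4)]
    by (intro sum.cong) (auto simp: basis_vec_in_vecs)
  also have "\<dots> = (\<Sum>p\<in>I. \<Sum>q\<in>J. (x p * y q) *\<^sub>C \<beta> (basis_vec p) (basis_vec q))"
    by (simp add: scaleC_sum_right scaleC_scaleC)
  also have "\<dots> = tensor_lift I J \<beta> (x \<otimes>\<^sub>t y)"
    by (simp add: tensor_lift_def tensor_def sum.cartesian_product)
  finally show ?thesis by simp
qed


section \<open>The algebra \<open>B = M\<^bsub>n(1)\<^esub>(\<complex>) \<oplus> \<dots> \<oplus> M\<^bsub>n(d)\<^esub>(\<complex>)\<close>\<close>

text \<open>An element \<open>x\<close> of \<open>B\<close> is given by its matrix entries: \<open>x (a, i, j)\<close> is the entry \<open>(i, j)\<close> of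
  the component of \<open>x\<close> in the \<open>a\<close>-th matrix block. All indices are 1-based.\<close>

type_synonym ix = "nat \<times> nat \<times> nat"
type_synonym elt = "ix \<Rightarrow> complex"
type_synonym elt2 = "ix \<times> ix \<Rightarrow> complex"

definition ixs :: "nat \<Rightarrow> (nat \<Rightarrow> nat) \<Rightarrow> ix set" where
  "ixs d n = {(a, i, j). a \<in> {1..d} \<and> i \<in> {1..n a} \<and> j \<in> {1..n a}}"

abbreviation B_carrier :: "nat \<Rightarrow> (nat \<Rightarrow> nat) \<Rightarrow> elt set" where
  "B_carrier d n \<equiv> vecs (ixs d n)"

abbreviation BB_carrier :: "nat \<Rightarrow> (nat \<Rightarrow> nat) \<Rightarrow> elt2 set" where
  "BB_carrier d n \<equiv> vecs (ixs d n \<times> ixs d n)"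

definition B_mult :: "(nat \<Rightarrow> nat) \<Rightarrow> elt \<Rightarrow> elt \<Rightarrow> elt" where
  "B_mult n x y = (\<lambda>(a, i, j). \<Sum>k\<in>{1..n a}. x (a, i, k) * y (a, k, j))"

definition B_star :: "elt \<Rightarrow> elt" where
  "B_star x = (\<lambda>(a, i, j). cnj (x (a, j, i)))"

definition B_one :: "nat \<Rightarrow> (nat \<Rightarrow> nat) \<Rightarrow> elt" where
  "B_one d n = (\<lambda>(a, i, j). if (a, i, j) \<in> ixs d n \<and> i = j then 1 else 0)"

definition block_trace :: "(nat \<Rightarrow> nat) \<Rightarrow> nat \<Rightarrow> elt \<Rightarrow> complex" where
  "block_trace n a x = (\<Sum>i\<in>{1..n a}. x (a, i, i))"

text \<open>The *-algebra structure of the tensor square of \<open>B\<close>: blockwise,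
  the product is that of the matrices with rows and columns indexed by pairs.\<close>

definition BB_mult :: "(nat \<Rightarrow> nat) \<Rightarrow> elt2 \<Rightarrow> elt2 \<Rightarrow> elt2" where
  "BB_mult n \<xi> \<eta> = (\<lambda>((a, i, j), (b, k, l)).
     \<Sum>p\<in>{1..n a}. \<Sum>q\<in>{1..n b}. \<xi> ((a, i, p), (b, k, q)) * \<eta> ((a, p, j), (b, q, l)))"

definition BB_star :: "elt2 \<Rightarrow> elt2" where
  "BB_star \<xi> = (\<lambda>((a, i, j), (b, k, l)). cnj (\<xi> ((a, j, i), (b, l, k))))"

lemma BB_mult_tensor: "BB_mult n (x \<otimes>\<^sub>t y) (z \<otimes>\<^sub>t w) = B_mult n x z \<otimes>\<^sub>t B_mult n y w"
  by (simp add: fun_eq_iff BB_mult_def B_mult_def tensor_def sum_product) (simp add: mult_ac)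

lemma BB_star_tensor: "BB_star (x \<otimes>\<^sub>t y) = B_star x \<otimes>\<^sub>t B_star y"
  by (auto simp: fun_eq_iff BB_star_def B_star_def tensor_def)


section \<open>States, \<open>\<delta>\<close>-forms and adapted matrix units\<close>

definition B_state :: "nat \<Rightarrow> (nat \<Rightarrow> nat) \<Rightarrow> (elt \<Rightarrow> complex) \<Rightarrow> bool" where
  "B_state d n \<psi> \<longleftrightarrow>
     linear_on_vecs (ixs d n) \<psi> \<and>
     (\<forall>x\<in>B_carrier d n. \<psi> (B_mult n (B_star x) x) \<in> \<real> \<and> 0 \<le> Re (\<psi> (B_mult n (B_star x) x))) \<and>
     \<psi> (B_one d n) = 1"

definition density_matrix :: "nat \<Rightarrow> (nat \<Rightarrow> nat) \<Rightarrow> (elt \<Rightarrow> complex) \<Rightarrow> elt \<Rightarrow> bool" where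
  "density_matrix d n \<psi> \<rho> \<longleftrightarrow>
     \<rho> \<in> B_carrier d n \<and>
     (\<forall>x\<in>B_carrier d n. \<psi> x = (\<Sum>a\<in>{1..d}. block_trace n a (B_mult n \<rho> x)))"

definition delta_form :: "nat \<Rightarrow> (nat \<Rightarrow> nat) \<Rightarrow> real \<Rightarrow> (elt \<Rightarrow> complex) \<Rightarrow> bool" where
  "delta_form d n \<delta> \<psi> \<longleftrightarrow>
     0 < \<delta> \<and> B_state d n \<psi> \<and>
     (\<exists>\<rho> \<sigma>. density_matrix d n \<psi> \<rho> \<and> \<sigma> \<in> B_carrier d n \<and>
        B_mult n \<rho> \<sigma> = B_one d n \<and> B_mult n \<sigma> \<rho> = B_one d n \<and>
        (\<forall>a\<in>{1..d}. block_trace n a \<sigma> = complex_of_real (\<delta>\<^sup>2)))"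

text \<open>\<open>e a i j\<close> is a system of matrix units of the \<open>a\<close>-th block (not necessarily the standard one).\<close>

definition matrix_units :: "nat \<Rightarrow> (nat \<Rightarrow> nat) \<Rightarrow> (nat \<Rightarrow> nat \<Rightarrow> nat \<Rightarrow> elt) \<Rightarrow> bool" where
  "matrix_units d n e \<longleftrightarrow>
     (\<forall>(a, i, j)\<in>ixs d n. e a i j \<in> vecs {p \<in> ixs d n. fst p = a} \<and> B_star (e a i j) = e a j i) \<and>
     (\<forall>(a, i, j)\<in>ixs d n. \<forall>(b, k, l)\<in>ixs d n.
        B_mult n (e a i j) (e b k l) = (if a = b \<and> j = k then e a i l else 0)) \<and>
     (\<forall>x\<in>B_carrier d n. \<exists>c. x = (\<Sum>(a, i, j)\<in>ixs d n. c a i j *\<^sub>C e a i j))"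

definition diagonal_wrt ::
  "nat \<Rightarrow> (nat \<Rightarrow> nat) \<Rightarrow> (nat \<Rightarrow> nat \<Rightarrow> nat \<Rightarrow> elt) \<Rightarrow> elt \<Rightarrow> bool" where
  "diagonal_wrt d n e \<rho> \<longleftrightarrow>
     (\<exists>r. \<rho> = (\<Sum>a\<in>{1..d}. \<Sum>i\<in>{1..n a}. r a i *\<^sub>C e a i i))"

text \<open>The values \<open>\<psi> (e a i i)\<close> occurring below are positive reals when \<open>\<psi>\<close> is a \<open>\<delta>\<close>-form.\<close>

definition adapted_unit ::
  "(elt \<Rightarrow> complex) \<Rightarrow> (nat \<Rightarrow> nat \<Rightarrow> nat \<Rightarrow> elt) \<Rightarrow> nat \<Rightarrow> nat \<Rightarrow> nat \<Rightarrow> elt" where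
  "adapted_unit \<psi> e a i j =
     complex_of_real (1 / sqrt (Re (\<psi> (e a i i))) * (1 / sqrt (Re (\<psi> (e a j j))))) *\<^sub>C e a i j"


section \<open>Comultiplication and quantum graphs\<close>

definition B_inner :: "(nat \<Rightarrow> nat) \<Rightarrow> (elt \<Rightarrow> complex) \<Rightarrow> elt \<Rightarrow> elt \<Rightarrow> complex" where
  "B_inner n \<psi> x y = \<psi> (B_mult n (B_star x) y)"

definition BB_inner ::
  "nat \<Rightarrow> (nat \<Rightarrow> nat) \<Rightarrow> (elt \<Rightarrow> complex) \<Rightarrow> elt2 \<Rightarrow> elt2 \<Rightarrow> complex" where
  "BB_inner d n \<psi> \<xi> \<eta> =
     tensor_lift (ixs d n) (ixs d n) (\<lambda>x y. \<psi> x * \<psi> y) (BB_mult n (BB_star \<xi>) \<eta>)"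

definition mult_map :: "nat \<Rightarrow> (nat \<Rightarrow> nat) \<Rightarrow> elt2 \<Rightarrow> elt" where
  "mult_map d n = tensor_lift (ixs d n) (ixs d n) (B_mult n)"

text \<open>The Hilbert space adjoint of \<^term>\<open>mult_map d n\<close>; existence and uniqueness hold because
  \<open>\<psi>\<close> is faithful when it is a \<open>\<delta>\<close>-form.\<close>

definition comult :: "nat \<Rightarrow> (nat \<Rightarrow> nat) \<Rightarrow> (elt \<Rightarrow> complex) \<Rightarrow> elt \<Rightarrow> elt2" where
  "comult d n \<psi> x = (THE \<xi>. \<xi> \<in> BB_carrier d n \<and>
     (\<forall>\<eta>\<in>BB_carrier d n. BB_inner d n \<psi> \<xi> \<eta> = B_inner n \<psi> x (mult_map d n \<eta>)))"

definition tensor_map ::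
  "nat \<Rightarrow> (nat \<Rightarrow> nat) \<Rightarrow> (elt \<Rightarrow> elt) \<Rightarrow> (elt \<Rightarrow> elt) \<Rightarrow> elt2 \<Rightarrow> elt2" where
  "tensor_map d n F G = tensor_lift (ixs d n) (ixs d n) (\<lambda>x y. F x \<otimes>\<^sub>t G y)"

definition quantum_adjacency ::
  "nat \<Rightarrow> (nat \<Rightarrow> nat) \<Rightarrow> real \<Rightarrow> (elt \<Rightarrow> complex) \<Rightarrow> (elt \<Rightarrow> elt) \<Rightarrow> bool" where
  "quantum_adjacency d n \<delta> \<psi> A \<longleftrightarrow>
     A ` B_carrier d n \<subseteq> B_carrier d n \<and> linear_on_vecs (ixs d n) A \<and>
     (\<forall>x\<in>B_carrier d n.
        mult_map d n (tensor_map d n A A (comult d n \<psi> x)) = complex_of_real (\<delta>\<^sup>2) *\<^sub>C A x)"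

definition finite_quantum_graph ::
  "nat \<Rightarrow> (nat \<Rightarrow> nat) \<Rightarrow> real \<Rightarrow> (elt \<Rightarrow> complex) \<Rightarrow> (elt \<Rightarrow> elt) \<Rightarrow> bool" where
  "finite_quantum_graph d n \<delta> \<psi> A \<longleftrightarrow> delta_form d n \<delta> \<psi> \<and> quantum_adjacency d n \<delta> \<psi> A"

text \<open>A \<open>k \<times> k\<close> matrix over \<open>B\<close> is positive if it is of the form \<open>Y\<^sup>* Y\<close>.\<close>

definition positive_matrix ::
  "nat \<Rightarrow> (nat \<Rightarrow> nat) \<Rightarrow> nat \<Rightarrow> (nat \<Rightarrow> nat \<Rightarrow> elt) \<Rightarrow> bool" where
  "positive_matrix d n k X \<longleftrightarrow>
     (\<exists>Y. (\<forall>r<k. \<forall>s<k. Y r s \<in> B_carrier d n) \<and>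
        (\<forall>r<k. \<forall>s<k. X r s = (\<Sum>t<k. B_mult n (B_star (Y t r)) (Y t s))))"

definition completely_positive :: "nat \<Rightarrow> (nat \<Rightarrow> nat) \<Rightarrow> (elt \<Rightarrow> elt) \<Rightarrow> bool" where
  "completely_positive d n A \<longleftrightarrow>
     (\<forall>k X. positive_matrix d n k X \<longrightarrow> positive_matrix d n k (\<lambda>r s. A (X r s)))"

definition edge_checker ::
  "nat \<Rightarrow> (nat \<Rightarrow> nat) \<Rightarrow> real \<Rightarrow> (elt \<Rightarrow> complex) \<Rightarrow> (elt \<Rightarrow> elt) \<Rightarrow> elt2" where
  "edge_checker d n \<delta> \<psi> A =
     complex_of_real (1 / \<delta>\<^sup>2) *\<^sub>C tensor_map d n (\<lambda>x. x) A (comult d n \<psi> (B_one d n))"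

definition bimodule_action :: "nat \<Rightarrow> (nat \<Rightarrow> nat) \<Rightarrow> elt \<Rightarrow> elt2 \<Rightarrow> elt \<Rightarrow> elt2" where
  "bimodule_action d n x \<xi> y =
     tensor_lift (ixs d n) (ixs d n) (\<lambda>u v. B_mult n x u \<otimes>\<^sub>t B_mult n v y) \<xi>"


section \<open>Local quantum Cuntz--Krieger families\<close>

definition star_map :: "(elt \<Rightarrow> 'c::unital_cstar_algebra) \<Rightarrow> elt \<Rightarrow> 'c" where
  "star_map S x = star (S (B_star x))"

text \<open>\<^term>\<open>prod_map d n S T\<close> is the composition of \<open>S \<otimes> T\<close> with the multiplication \<open>\<mu>\<close> of the
  target algebra.\<close>

definition prod_map ::
  "nat \<Rightarrow> (nat \<Rightarrow> nat) \<Rightarrow> (elt \<Rightarrow> 'c) \<Rightarrow> (elt \<Rightarrow> 'c) \<Rightarrow> elt2 \<Rightarrow> 'c::unital_cstar_algebra" where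
  "prod_map d n S T = tensor_lift (ixs d n) (ixs d n) (\<lambda>x y. S x * T y)"

text \<open>Likewise \<open>\<mu>(\<mu> \<otimes> id)(S \<otimes> T \<otimes> U)\<close>, on \<open>(B \<otimes> B) \<otimes> B\<close>.\<close>

definition prod_map3 ::
  "nat \<Rightarrow> (nat \<Rightarrow> nat) \<Rightarrow> (elt \<Rightarrow> 'c) \<Rightarrow> (elt \<Rightarrow> 'c) \<Rightarrow> (elt \<Rightarrow> 'c)
     \<Rightarrow> ((ix \<times> ix) \<times> ix \<Rightarrow> complex) \<Rightarrow> 'c::unital_cstar_algebra" where
  "prod_map3 d n S T U =
     tensor_lift (ixs d n \<times> ixs d n) (ixs d n) (\<lambda>\<xi> z. prod_map d n S T \<xi> * U z)"

text \<open>\<open>m\<^sup>* \<otimes> id\<close>\<close>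

definition comult_id ::
  "nat \<Rightarrow> (nat \<Rightarrow> nat) \<Rightarrow> (elt \<Rightarrow> complex) \<Rightarrow> elt2 \<Rightarrow> (ix \<times> ix) \<times> ix \<Rightarrow> complex" where
  "comult_id d n \<psi> = tensor_lift (ixs d n) (ixs d n) (\<lambda>x y. comult d n \<psi> x \<otimes>\<^sub>t y)"

definition local_qck_family ::
  "nat \<Rightarrow> (nat \<Rightarrow> nat) \<Rightarrow> real \<Rightarrow> (elt \<Rightarrow> complex) \<Rightarrow> (elt \<Rightarrow> elt)
     \<Rightarrow> (elt \<Rightarrow> 'c::unital_cstar_algebra) \<Rightarrow> bool" where
  "local_qck_family d n \<delta> \<psi> A S \<longleftrightarrow>
     linear_on_vecs (ixs d n) S \<and>
     (\<forall>\<xi>\<in>BB_carrier d n.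
        prod_map3 d n S (star_map S) S (comult_id d n \<psi> \<xi>)
          = complex_of_real (1 / \<delta>\<^sup>2) *\<^sub>C S (mult_map d n \<xi>)) \<and>
     (\<forall>\<xi>\<in>BB_carrier d n.
        prod_map d n (star_map S) S \<xi>
          = complex_of_real (1 / \<delta>\<^sup>2) *\<^sub>C
              prod_map d n S (star_map S) (comult d n \<psi> (A (mult_map d n \<xi>)))) \<and>
     prod_map d n S (star_map S) (comult d n \<psi> (B_one d n)) = complex_of_real (1 / \<delta>\<^sup>2) *\<^sub>C 1"

end

theory Submission
  imports Defs
begin

text \<open>The three statements are cases of product formulas that hold for arbitrary elements of \<open>B\<close>. Let
  \<open>(g\<^sub>p)\<close> be an orthonormal basis of \<open>B\<close> for the inner product \<open>\<psi>(x\<^sup>* y)\<close>. Then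
  \<open>m\<^sup>*(x) = \<Sum>\<^sub>p x g\<^sub>p \<otimes> g\<^sub>p\<^sup>* = \<Sum>\<^sub>p g\<^sub>p \<otimes> g\<^sub>p\<^sup>* x\<close> (\<open>comult_eq\<close>, \<open>frame_bimodule\<close>). With the map
  \<open>P = \<mu>(S \<otimes> S\<^sup>*)m\<^sup>*\<close> from \<open>B\<close> to the target algebra, the first two Cuntz--Krieger relations become

  \<open>P(x) S(y) = \<delta>\<^bsup>-2\<^esup> S(xy)\<close> and \<open>S(x)\<^sup>* S(y) = \<delta>\<^bsup>-2\<^esup> P(A(x\<^sup>* y))\<close>.

  The second relation gives the first claim, because \<open>x\<^sup>* y = 0\<close> for \<open>x = f\<^sub>i\<^sub>j\<close> and \<open>y = f\<^sub>k\<^sub>l\<close> unless both lie in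
  the same block and \<open>i = k\<close>. Since \<open>P(x) = \<Sum>\<^sub>p S(x g\<^sub>p) S(g\<^sub>p)\<^sup>*\<close>, the two relations also give
  \<open>P(x) P(y) = \<delta>\<^bsup>-2\<^esup> P(xy)\<close>, \<open>P(x)\<^sup>* = P(x\<^sup>*)\<close> and, on expanding \<open>S(x) = \<delta>\<^sup>2 P(1) S(x)\<close>,

  \<open>S(x) = \<Sum>\<^sub>p S(g\<^sub>p) P(A(g\<^sub>p\<^sup>* x))\<close>.

  The tensors \<open>g\<^sub>p \<otimes> A(g\<^sub>p\<^sup>* x)\<close> add up to \<open>\<delta>\<^sup>2 x \<cdot> \<epsilon>\<close>, for the edge checker \<open>\<epsilon>\<close>. Multiplying the
  expansion on the right by \<open>S(y)\<close>, or by the adjoint of the expansion of \<open>S(y)\<close>, yields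

  \<open>S(x) S(y) = \<mu>(S \<otimes> S)(x \<cdot> \<epsilon> \<cdot> y)\<close> and
  \<open>S(x) S(y)\<^sup>* = \<Sum>\<^sub>q \<mu>(S \<otimes> P)(x \<cdot> \<epsilon> \<cdot> A(y\<^sup>* g\<^sub>q)) S(g\<^sub>q)\<^sup>*\<close>

  (\<open>S_mult_S\<close>, \<open>S_mult_star_S\<close>). Complete positivity enters the last formula in the form
  \<open>A(x\<^sup>*) = A(x)\<^sup>*\<close>. For matrix units \<open>e\<close> that diagonalise the density, the elements
  \<open>\<psi>(e\<^sub>s\<^sub>s)\<^bsup>-1/2\<^esup> e\<^sub>r\<^sub>s\<close> form such an orthonormal basis, and for \<open>y = f\<^sub>k\<^sub>l\<close> each \<open>y\<^sup>* g\<^sub>q\<close> is zero or a multiple of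
  some \<open>f\<^sub>l\<^sub>s\<close>, so the last two claims follow.\<close>

section \<open>Linear and bilinear maps on coordinate spaces\<close>

lemma vecs_zero: "0 \<in> vecs I"
  by (simp add: vecs_def)

lemma vecs_add: "x \<in> vecs I \<Longrightarrow> y \<in> vecs I \<Longrightarrow> x + y \<in> vecs I"
  by (simp add: vecs_def)

lemma vecs_scaleC: "x \<in> vecs I \<Longrightarrow> c *\<^sub>C x \<in> vecs I"
  by (simp add: vecs_def scaleC_fun_def scaleC_complex_def)

lemma vecs_sum: "(\<And>k. k \<in> K \<Longrightarrow> x k \<in> vecs I) \<Longrightarrow> (\<Sum>k\<in>K. x k) \<in> vecs I"
  by (induction K rule: infinite_finite_induct) (auto intro: vecs_zero vecs_add)

lemma tensor_in_vecs: "x \<in> vecs I \<Longrightarrow> y \<in> vecs J \<Longrightarrow> x \<otimes>\<^sub>t y \<in> vecs (I \<times> J)"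
  by (auto simp: vecs_def tensor_def)

lemma sum_fun_apply: "(\<Sum>k\<in>K. g k) x = (\<Sum>k\<in>K. g k x :: 'v::comm_monoid_add)"
  by (induction K rule: infinite_finite_induct) auto

lemma linear_on_vecsI:
  assumes "\<And>x y. x \<in> vecs I \<Longrightarrow> y \<in> vecs I \<Longrightarrow> f (x + y) = f x + f y"
    and "\<And>c x. x \<in> vecs I \<Longrightarrow> f (c *\<^sub>C x) = c *\<^sub>C f x"
  shows "linear_on_vecs I f"
  using assms by (simp add: linear_on_vecs_def)

lemma linear_on_vecs_add:
  "linear_on_vecs I f \<Longrightarrow> x \<in> vecs I \<Longrightarrow> y \<in> vecs I \<Longrightarrow> f (x + y) = f x + f y"
  by (simp add: linear_on_vecs_def)

lemma linear_on_vecs_scaleC: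
  "linear_on_vecs I f \<Longrightarrow> x \<in> vecs I \<Longrightarrow> f (c *\<^sub>C x) = c *\<^sub>C f x"
  by (simp add: linear_on_vecs_def)

lemma linear_on_vecs_zero: "linear_on_vecs I f \<Longrightarrow> f 0 = 0"
  using linear_on_vecs_scaleC[of I f 0 0] by (simp add: vecs_zero scaleC_zero_left)

lemma linear_on_vecs_sum:
  assumes "linear_on_vecs I f" "\<And>k. k \<in> K \<Longrightarrow> x k \<in> vecs I"
  shows "f (\<Sum>k\<in>K. x k) = (\<Sum>k\<in>K. f (x k))"
  using assms(2)
  by (induction K rule: infinite_finite_induct)
    (simp_all add: linear_on_vecs_zero[OF assms(1)] linear_on_vecs_add[OF assms(1)] vecs_sum)

lemma linear_on_vecs_compose:
  assumes "linear_on_vecs I f" "linear_on_vecs J h" "\<And>x. x \<in> vecs I \<Longrightarrow> f x \<in> vecs J"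
  shows "linear_on_vecs I (\<lambda>x. h (f x))"
  using assms by (simp add: linear_on_vecs_def)

lemma linear_on_vecs_sum_fun:
  assumes "\<And>k. k \<in> K \<Longrightarrow> linear_on_vecs I (f k)"
  shows "linear_on_vecs I (\<lambda>x. \<Sum>k\<in>K. f k x)"
  using assms by (auto intro!: linear_on_vecsI simp: linear_on_vecs_def sum.distrib scaleC_sum_right)

lemma linear_on_vecs_mult_right:
  "linear_on_vecs I f \<Longrightarrow> linear_on_vecs I (\<lambda>x. f x * (c::'c::unital_cstar_algebra))"
  by (simp add: linear_on_vecs_def distrib_right scaleC_mult_left)

lemma linear_on_vecs_mult_left:
  "linear_on_vecs I f \<Longrightarrow> linear_on_vecs I (\<lambda>x. (c::'c::unital_cstar_algebra) * f x)"
  by (simp add: linear_on_vecs_def distrib_left scaleC_mult_right)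

lemma linear_on_vecs_scaleC_fixed:
  "linear_on_vecs I \<phi> \<Longrightarrow> linear_on_vecs I (\<lambda>x. \<phi> x *\<^sub>C v)"
  by (simp add: linear_on_vecs_def scaleC_add_left scaleC_scaleC scaleC_complex_def)

lemma linear_on_vecs_ext:
  assumes "finite I" "linear_on_vecs I f" "linear_on_vecs I h"
    and "\<And>p. p \<in> I \<Longrightarrow> f (basis_vec p) = h (basis_vec p)" and "x \<in> vecs I"
  shows "f x = h x"
  unfolding linear_on_vecs_expand[OF assms(1,2,5)] linear_on_vecs_expand[OF assms(1,3,5)]
  by (intro sum.cong) (auto simp: assms(4))

lemma basis_vec_pair: "basis_vec (p, q) = basis_vec p \<otimes>\<^sub>t basis_vec q"
  by (auto simp: basis_vec_def tensor_def fun_eq_iff)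

lemma linear_on_tensors_ext:
  assumes "finite I" "finite J" "linear_on_vecs (I \<times> J) f" "linear_on_vecs (I \<times> J) h"
    and "\<And>x y. x \<in> vecs I \<Longrightarrow> y \<in> vecs J \<Longrightarrow> f (x \<otimes>\<^sub>t y) = h (x \<otimes>\<^sub>t y)"
    and "\<xi> \<in> vecs (I \<times> J)"
  shows "f \<xi> = h \<xi>"
proof (rule linear_on_vecs_ext[OF _ assms(3,4) _ assms(6)])
  show "finite (I \<times> J)" using assms(1,2) by simp
  show "f (basis_vec r) = h (basis_vec r)" if "r \<in> I \<times> J" for r
    using that by (cases r) (auto simp: basis_vec_pair intro!: assms(5) basis_vec_in_vecs)
qed

definition bilinear_on_vecs ::
  "'p set \<Rightarrow> 'q set \<Rightarrow> (('p \<Rightarrow> complex) \<Rightarrow> ('q \<Rightarrow> complex) \<Rightarrow> 'v::complex_vector_space) \<Rightarrow> bool" where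
  "bilinear_on_vecs I J \<beta> \<longleftrightarrow>
     (\<forall>y\<in>vecs J. linear_on_vecs I (\<lambda>x. \<beta> x y)) \<and> (\<forall>x\<in>vecs I. linear_on_vecs J (\<beta> x))"

lemma bilinear_on_vecsI:
  assumes "\<And>y. y \<in> vecs J \<Longrightarrow> linear_on_vecs I (\<lambda>x. \<beta> x y)"
    and "\<And>x. x \<in> vecs I \<Longrightarrow> linear_on_vecs J (\<lambda>y. \<beta> x y)"
  shows "bilinear_on_vecs I J \<beta>"
  using assms by (simp add: bilinear_on_vecs_def)

lemma tensor_lift_bilinear:
  assumes "finite I" "finite J" "bilinear_on_vecs I J \<beta>" "x \<in> vecs I" "y \<in> vecs J"
  shows "tensor_lift I J \<beta> (x \<otimes>\<^sub>t y) = \<beta> x y"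
  using assms by (intro tensor_lift_tensor) (auto simp: bilinear_on_vecs_def)

lemma linear_on_vecs_tensor_lift: "linear_on_vecs (I \<times> J) (tensor_lift I J \<beta>)"
  by (intro linear_on_vecsI)
    (auto simp: tensor_lift_def scaleC_add_left sum.distrib scaleC_sum_right scaleC_scaleC
      scaleC_fun_def scaleC_complex_def case_prod_beta)

lemma tensor_lift_sum:
  assumes "finite I" "finite J" "bilinear_on_vecs I J \<beta>"
    and "\<And>k. k \<in> K \<Longrightarrow> x k \<in> vecs I" "\<And>k. k \<in> K \<Longrightarrow> y k \<in> vecs J"
  shows "tensor_lift I J \<beta> (\<Sum>k\<in>K. x k \<otimes>\<^sub>t y k) = (\<Sum>k\<in>K. \<beta> (x k) (y k))"
  using assms
  by (subst linear_on_vecs_sum[OF linear_on_vecs_tensor_lift])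
    (auto intro!: tensor_in_vecs sum.cong tensor_lift_bilinear)

lemma tensor_add_left: "(x + y) \<otimes>\<^sub>t z = x \<otimes>\<^sub>t z + y \<otimes>\<^sub>t z"
  and tensor_add_right: "x \<otimes>\<^sub>t (z + w) = x \<otimes>\<^sub>t z + x \<otimes>\<^sub>t w"
  and tensor_scaleC_left: "(c *\<^sub>C x) \<otimes>\<^sub>t z = c *\<^sub>C (x \<otimes>\<^sub>t z)"
  and tensor_scaleC_right: "x \<otimes>\<^sub>t (c *\<^sub>C z) = c *\<^sub>C (x \<otimes>\<^sub>t z)"
  by (auto simp: tensor_def fun_eq_iff scaleC_fun_def scaleC_complex_def algebra_simps)

lemma linear_on_vecs_tensor_left:
  "linear_on_vecs I f \<Longrightarrow> linear_on_vecs I (\<lambda>x. f x \<otimes>\<^sub>t z)"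
  by (simp add: linear_on_vecs_def tensor_add_left tensor_scaleC_left)

lemma linear_on_vecs_tensor_right:
  "linear_on_vecs I f \<Longrightarrow> linear_on_vecs I (\<lambda>x. z \<otimes>\<^sub>t f x)"
  by (simp add: linear_on_vecs_def tensor_add_right tensor_scaleC_right)

lemma linear_on_vecs_ident: "linear_on_vecs I (\<lambda>x. x)"
  by (simp add: linear_on_vecs_def)


section \<open>The *-algebra \<open>B\<close> and the involution of the target algebra\<close>

lemma finite_ixs: "finite (ixs d n)"
proof -
  have "ixs d n = (SIGMA a:{1..d}. {1..n a} \<times> {1..n a})"
    by (auto simp: ixs_def)
  then show ?thesis by simp
qed

lemma B_mult_closed:
  assumes "x \<in> B_carrier d n" "y \<in> B_carrier d n"
  shows "B_mult n x y \<in> B_carrier d n"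
  using assms by (auto simp: vecs_def B_mult_def ixs_def intro!: sum.neutral)

lemma B_star_closed: "x \<in> B_carrier d n \<Longrightarrow> B_star x \<in> B_carrier d n"
  by (auto simp: vecs_def B_star_def ixs_def)

lemma B_one_closed: "B_one d n \<in> B_carrier d n"
  by (auto simp: vecs_def B_one_def)

lemma B_mult_assoc: "B_mult n (B_mult n x y) z = B_mult n x (B_mult n y z)"
proof -
  have "(\<Sum>k\<in>{1..m}. (\<Sum>l\<in>{1..m}. f l * g l k) * h k) = (\<Sum>l\<in>{1..m}. f l * (\<Sum>k\<in>{1..m}. g l k * h k))"
    for m :: nat and f h :: "nat \<Rightarrow> complex" and g
    unfolding sum_distrib_left sum_distrib_right
    by (subst sum.swap) (simp add: mult.assoc)
  then show ?thesis by (auto simp: B_mult_def fun_eq_iff)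
qed

lemma B_star_star: "B_star (B_star x) = x"
  by (auto simp: B_star_def fun_eq_iff)

lemma B_star_mult: "B_star (B_mult n x y) = B_mult n (B_star y) (B_star x)"
  by (auto simp: B_star_def B_mult_def fun_eq_iff mult.commute)

lemma B_star_add: "B_star (x + y) = B_star x + B_star y"
  and B_star_scaleC: "B_star (c *\<^sub>C x) = cnj c *\<^sub>C B_star x"
  by (auto simp: B_star_def fun_eq_iff scaleC_fun_def scaleC_complex_def)

lemma B_star_sum: "B_star (\<Sum>k\<in>K. x k) = (\<Sum>k\<in>K. B_star (x k))"
  by (auto simp: B_star_def fun_eq_iff sum_fun_apply)

lemma B_one_mult:
  assumes "x \<in> B_carrier d n"
  shows "B_mult n (B_one d n) x = x"
proof (intro ext)
  fix p :: ix
  obtain a i j where p: "p = (a, i, j)" by (cases p)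
  have "B_mult n (B_one d n) x p = (\<Sum>k\<in>{1..n a}. if k = i then (if (a, i, i) \<in> ixs d n then x (a, i, j) else 0) else 0)"
    unfolding p B_mult_def prod.case by (intro sum.cong refl) (auto simp: B_one_def)
  also have "\<dots> = x p"
    using assms by (auto simp: p vecs_def ixs_def)
  finally show "B_mult n (B_one d n) x p = x p" .
qed

lemma B_star_one: "B_star (B_one d n) = B_one d n"
  by (auto simp: B_star_def B_one_def fun_eq_iff ixs_def)

lemma B_mult_one:
  assumes "x \<in> B_carrier d n"
  shows "B_mult n x (B_one d n) = x"
  by (metis B_one_mult[OF B_star_closed[OF assms]] B_star_mult B_star_one B_star_star)

lemma B_mult_add_left: "B_mult n (x + y) z = B_mult n x z + B_mult n y z"
  and B_mult_add_right: "B_mult n x (y + z) = B_mult n x y + B_mult n x z"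
  and B_mult_scaleC_left: "B_mult n (c *\<^sub>C x) z = c *\<^sub>C B_mult n x z"
  and B_mult_scaleC_right: "B_mult n x (c *\<^sub>C z) = c *\<^sub>C B_mult n x z"
  by (auto simp: B_mult_def fun_eq_iff scaleC_fun_def scaleC_complex_def
      sum.distrib sum_distrib_left algebra_simps)

lemma linear_on_vecs_B_mult_left: "linear_on_vecs I (\<lambda>x. B_mult n x y)"
  and linear_on_vecs_B_mult_right: "linear_on_vecs I (\<lambda>y. B_mult n x y)"
  by (simp_all add: linear_on_vecs_def B_mult_add_left B_mult_add_right
      B_mult_scaleC_left B_mult_scaleC_right)

lemma B_mult_zero_left: "B_mult n 0 y = 0" and B_mult_zero_right: "B_mult n x 0 = 0"
  by (auto simp: B_mult_def fun_eq_iff)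

lemma linear_on_vecs_BB_mult_left: "linear_on_vecs I (\<lambda>\<xi>. BB_mult n \<xi> \<eta>)"
  and linear_on_vecs_BB_mult_right: "linear_on_vecs I (\<lambda>\<eta>. BB_mult n \<xi> \<eta>)"
  by (auto intro!: linear_on_vecsI simp: BB_mult_def fun_eq_iff scaleC_fun_def scaleC_complex_def
      sum.distrib sum_distrib_left algebra_simps)

lemma BB_mult_closed:
  assumes "\<xi> \<in> BB_carrier d n" "\<eta> \<in> BB_carrier d n"
  shows "BB_mult n \<xi> \<eta> \<in> BB_carrier d n"
proof -
  \<comment> \<open>an entry outside the index set is a sum of products in which one factor lies outside it\<close>
  have "\<xi> ((a, i, p), b, k, q) = 0 \<or> \<eta> ((a, p, j), b, q, l) = 0"
    if "\<not> ((a, i, j) \<in> ixs d n \<and> (b, k, l) \<in> ixs d n)" for a b i j k l p q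
  proof -
    have "\<not> ((a, i, p) \<in> ixs d n \<and> (b, k, q) \<in> ixs d n) \<or>
        \<not> ((a, p, j) \<in> ixs d n \<and> (b, q, l) \<in> ixs d n)"
      using that by (auto simp: ixs_def)
    then show ?thesis using assms unfolding vecs_def by blast
  qed
  then show ?thesis
    unfolding vecs_def BB_mult_def
    by (simp only: split_paired_all mem_Collect_eq split_paired_All prod.case mem_Times_iff fst_conv snd_conv)
      (intro allI impI sum.neutral ballI, simp only: mult_eq_0_iff)
qed

lemma BB_star_sum: "BB_star (\<Sum>k\<in>K. x k) = (\<Sum>k\<in>K. BB_star (x k))"
  by (auto simp: BB_star_def fun_eq_iff sum_fun_apply)

lemma ixs_swap: "(a, i, j) \<in> ixs d n \<Longrightarrow> (a, j, i) \<in> ixs d n"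
  by (auto simp: ixs_def)

lemma BB_star_closed: "\<xi> \<in> BB_carrier d n \<Longrightarrow> BB_star \<xi> \<in> BB_carrier d n"
  unfolding vecs_def BB_star_def using ixs_swap by fastforce

lemma BB_star_star: "BB_star (BB_star \<xi>) = \<xi>"
  by (auto simp: BB_star_def fun_eq_iff)

lemma star_zero: "star 0 = (0::'c::unital_cstar_algebra)"
  using star_scaleC[of 0 0] by (simp add: scaleC_zero_left)

lemma star_sum: "star (\<Sum>k\<in>K. x k) = (\<Sum>k\<in>K. star (x k :: 'c::unital_cstar_algebra))"
  by (induction K rule: infinite_finite_induct) (auto simp: star_zero star_add)

lemma linear_on_vecs_star_map:
  "linear_on_vecs (ixs d n) S \<Longrightarrow> linear_on_vecs (ixs d n) (star_map S)"
  by (intro linear_on_vecsI)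
    (auto simp: star_map_def B_star_add B_star_scaleC linear_on_vecs_add linear_on_vecs_scaleC
      B_star_closed star_add star_scaleC)

lemma bilinear_prod:
  fixes S T :: "elt \<Rightarrow> 'c::unital_cstar_algebra"
  assumes "linear_on_vecs I S" "linear_on_vecs J T"
  shows "bilinear_on_vecs I J (\<lambda>x y. S x * T y)"
  using assms by (auto intro!: bilinear_on_vecsI linear_on_vecs_mult_right linear_on_vecs_mult_left)

text \<open>The row \<open>(1, x)\<close> gives the positive matrix with entries \<open>1, x, x\<^sup>*, x\<^sup>* x\<close>. Its image under \<open>A\<close> is again of the form \<open>Z\<^sup>* Z\<close>,
  hence hermitian, and the off-diagonal entries are \<open>A(x)\<close> and \<open>A(x\<^sup>*)\<close>.\<close>

lemma completely_positive_star:
  assumes cp: "completely_positive d n A" and x: "x \<in> B_carrier d n"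
  shows "A (B_star x) = B_star (A x)"
proof -
  \<comment> \<open>the row is padded by a zero row, as the factor in a positive matrix has to be square\<close>
  define Y where "Y t s = (if t = 0 then if s = 0 then B_one d n else x else 0)" for t s :: nat
  define X where "X r s = (\<Sum>t<2. B_mult n (B_star (Y t r)) (Y t s))" for r s :: nat
  have X: "X 0 1 = x" "X 1 0 = B_star x"
    by (simp_all add: X_def Y_def numeral_2_eq_2 lessThan_Suc B_star_one B_one_mult[OF x]
        B_mult_one[OF B_star_closed[OF x]] B_mult_zero_right)
  have "positive_matrix d n 2 X"
    unfolding positive_matrix_def
    by (rule exI[of _ Y]) (auto simp: X_def Y_def B_one_closed x vecs_zero)
  then have "positive_matrix d n 2 (\<lambda>r s. A (X r s))"
    using cp by (simp add: completely_positive_def)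
  then obtain Z :: "nat \<Rightarrow> nat \<Rightarrow> elt" where Z: "\<And>r s. r < 2 \<Longrightarrow> s < 2 \<Longrightarrow>
      A (X r s) = (\<Sum>t<2. B_mult n (B_star (Z t r)) (Z t s))"
    unfolding positive_matrix_def by blast
  have "B_star (A (X 0 1)) = A (X 1 0)"
    by (simp add: Z B_star_sum B_star_mult B_star_star)
  then show ?thesis by (simp only: X)
qed


section \<open>The comultiplication in a Parseval frame\<close>

text \<open>For a faithful state the first expansion says that \<open>(g\<^sub>p)\<close> is a Parseval frame for the inner product
  \<open>\<psi>(x\<^sup>* y)\<close>, for example
  an orthonormal basis. The second expansion is the involution applied to the first one at \<open>x\<^sup>*\<close>. Stating both keeps every step
  linear in \<open>x\<close>.\<close>

locale parseval_frame =
  fixes d :: nat and n :: "nat \<Rightarrow> nat" and \<psi> :: "elt \<Rightarrow> complex"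
    and K :: "'k set" and g :: "'k \<Rightarrow> elt"
  assumes psi_linear: "linear_on_vecs (ixs d n) \<psi>"
    and frame_closed: "p \<in> K \<Longrightarrow> g p \<in> B_carrier d n"
    and frame_expand: "x \<in> B_carrier d n \<Longrightarrow> (\<Sum>p\<in>K. \<psi> (B_mult n (B_star (g p)) x) *\<^sub>C g p) = x"
    and frame_expand_star:
      "x \<in> B_carrier d n \<Longrightarrow> (\<Sum>p\<in>K. \<psi> (B_mult n x (g p)) *\<^sub>C B_star (g p)) = x"
begin

text \<open>Both sides have the matrix coefficients \<open>\<psi>(g\<^sub>q\<^sup>* x g\<^sub>p)\<close>: expand \<open>x g\<^sub>p\<close> in the \<open>g\<^sub>q\<close> on the left and
  \<open>g\<^sub>q\<^sup>* x\<close> in the \<open>g\<^sub>p\<^sup>*\<close> on the right. This is the statement that \<open>m\<^sup>*\<close> is a bimodule map.\<close>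

lemma frame_bimodule:
  assumes \<beta>: "bilinear_on_vecs (ixs d n) (ixs d n) \<beta>" and x: "x \<in> B_carrier d n"
  shows "(\<Sum>p\<in>K. \<beta> (B_mult n x (g p)) (B_star (g p))) = (\<Sum>p\<in>K. \<beta> (g p) (B_mult n (B_star (g p)) x))"
proof -
  let ?c = "\<lambda>q p. \<psi> (B_mult n (B_star (g q)) (B_mult n x (g p)))"
  note closed = frame_closed B_star_closed B_mult_closed x
  have "\<beta> (B_mult n x (g p)) (B_star (g p)) = (\<Sum>q\<in>K. ?c q p *\<^sub>C \<beta> (g q) (B_star (g p)))"
    if p: "p \<in> K" for p
  proof -
    have lin: "linear_on_vecs (ixs d n) (\<lambda>u. \<beta> u (B_star (g p)))"
      using \<beta> p by (auto simp: bilinear_on_vecs_def closed)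
    have "\<beta> (B_mult n x (g p)) (B_star (g p)) = \<beta> (\<Sum>q\<in>K. ?c q p *\<^sub>C g q) (B_star (g p))"
      using p by (simp add: frame_expand closed)
    then show ?thesis
      using p by (simp add: linear_on_vecs_sum[OF lin] linear_on_vecs_scaleC[OF lin] vecs_scaleC closed)
  qed
  moreover have "\<beta> (g q) (B_mult n (B_star (g q)) x) = (\<Sum>p\<in>K. ?c q p *\<^sub>C \<beta> (g q) (B_star (g p)))"
    if q: "q \<in> K" for q
  proof -
    have lin: "linear_on_vecs (ixs d n) (\<beta> (g q))"
      using \<beta> q by (auto simp: bilinear_on_vecs_def closed)
    have "\<beta> (g q) (B_mult n (B_star (g q)) x) = \<beta> (g q) (\<Sum>p\<in>K. ?c q p *\<^sub>C B_star (g p))"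
      using q frame_expand_star[of "B_mult n (B_star (g q)) x"] by (simp add: closed B_mult_assoc)
    then show ?thesis
      using q by (simp add: linear_on_vecs_sum[OF lin] linear_on_vecs_scaleC[OF lin] vecs_scaleC closed)
  qed
  ultimately show ?thesis
    using sum.swap[of "\<lambda>p q. ?c q p *\<^sub>C \<beta> (g q) (B_star (g p))" K K] by simp
qed

abbreviation frame_comult :: "elt \<Rightarrow> elt2" where
  "frame_comult x \<equiv> \<Sum>p\<in>K. B_mult n x (g p) \<otimes>\<^sub>t B_star (g p)"

lemma frame_comult_closed: "x \<in> B_carrier d n \<Longrightarrow> frame_comult x \<in> BB_carrier d n"
  by (intro vecs_sum tensor_in_vecs B_mult_closed B_star_closed frame_closed)

lemma bilinear_psi: "bilinear_on_vecs (ixs d n) (ixs d n) (\<lambda>x y. \<psi> x * \<psi> y)"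
  using psi_linear
  by (auto intro!: bilinear_on_vecsI linear_on_vecs_mult_right linear_on_vecs_mult_left)

abbreviation psi2 :: "elt2 \<Rightarrow> complex" where
  "psi2 \<equiv> tensor_lift (ixs d n) (ixs d n) (\<lambda>x y. \<psi> x * \<psi> y)"

lemma psi2_tensor: "x \<in> B_carrier d n \<Longrightarrow> y \<in> B_carrier d n \<Longrightarrow> psi2 (x \<otimes>\<^sub>t y) = \<psi> x * \<psi> y"
  using tensor_lift_bilinear[OF finite_ixs finite_ixs bilinear_psi] by blast

lemma linear_psi2_mult:
  "\<xi> \<in> BB_carrier d n \<Longrightarrow> linear_on_vecs (ixs d n \<times> ixs d n) (\<lambda>\<eta>. psi2 (BB_mult n \<xi> \<eta>))"
  by (rule linear_on_vecs_compose[OF linear_on_vecs_BB_mult_right linear_on_vecs_tensor_lift])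
    (rule BB_mult_closed)

text \<open>On a simple tensor \<open>y \<otimes> z\<close> the left side is \<open>\<Sum>\<^sub>p \<psi>(g\<^sub>p\<^sup>* x\<^sup>* y) \<psi>(g\<^sub>p z)\<close>, and summing the expansion of \<open>x\<^sup>* y\<close> turns this into
  \<open>\<psi>(x\<^sup>* y z)\<close>.\<close>

lemma frame_comult_adjoint:
  assumes x: "x \<in> B_carrier d n" and \<eta>: "\<eta> \<in> BB_carrier d n"
  shows "BB_inner d n \<psi> (frame_comult x) \<eta> = B_inner n \<psi> x (mult_map d n \<eta>)"
proof -
  note closed = frame_closed B_star_closed B_mult_closed x
  have mm: "mult_map d n (y \<otimes>\<^sub>t z) = B_mult n y z" if "y \<in> B_carrier d n" "z \<in> B_carrier d n" for y z
    unfolding mult_map_def using that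
    by (intro tensor_lift_bilinear finite_ixs bilinear_on_vecsI linear_on_vecs_B_mult_left
        linear_on_vecs_B_mult_right)
  have mm_closed: "mult_map d n \<eta> \<in> B_carrier d n" for \<eta>
    unfolding mult_map_def tensor_lift_def case_prod_beta
    by (auto intro!: vecs_sum vecs_scaleC B_mult_closed basis_vec_in_vecs)
  show ?thesis
    unfolding BB_inner_def B_inner_def
  proof (rule linear_on_tensors_ext[OF finite_ixs finite_ixs _ _ _ \<eta>])
    show "linear_on_vecs (ixs d n \<times> ixs d n) (\<lambda>\<eta>. psi2 (BB_mult n (BB_star (frame_comult x)) \<eta>))"
      by (intro linear_psi2_mult BB_star_closed frame_comult_closed x)
    show "linear_on_vecs (ixs d n \<times> ixs d n) (\<lambda>\<eta>. \<psi> (B_mult n (B_star x) (mult_map d n \<eta>)))"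
    proof (rule linear_on_vecs_compose[where f="mult_map d n"])
      show "linear_on_vecs (ixs d n \<times> ixs d n) (mult_map d n)"
        unfolding mult_map_def by (rule linear_on_vecs_tensor_lift)
      show "linear_on_vecs (ixs d n) (\<lambda>y. \<psi> (B_mult n (B_star x) y))"
        by (rule linear_on_vecs_compose[OF linear_on_vecs_B_mult_right psi_linear]) (intro closed)
    qed (rule mm_closed)
    fix y z assume yz: "y \<in> B_carrier d n" "z \<in> B_carrier d n"
    let ?u = "B_mult n (B_star x) y"
    have u: "?u \<in> B_carrier d n" by (intro closed yz)
    have linz: "linear_on_vecs (ixs d n) (\<lambda>v. \<psi> (B_mult n v z))"
      by (rule linear_on_vecs_compose[OF linear_on_vecs_B_mult_left psi_linear]) (intro closed yz)
    have "psi2 (BB_mult n (BB_star (frame_comult x)) (y \<otimes>\<^sub>t z)) =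
        psi2 (\<Sum>p\<in>K. B_mult n (B_star (g p)) ?u \<otimes>\<^sub>t B_mult n (g p) z)"
      by (simp add: BB_star_sum linear_on_vecs_sum[OF linear_on_vecs_BB_mult_left[of UNIV]]
          vecs_def BB_star_tensor BB_mult_tensor B_star_mult B_star_star B_mult_assoc)
    also have "\<dots> = (\<Sum>p\<in>K. \<psi> (B_mult n (B_star (g p)) ?u) * \<psi> (B_mult n (g p) z))"
      by (intro tensor_lift_sum finite_ixs bilinear_psi) (auto intro!: closed yz)
    also have "\<dots> = \<psi> (B_mult n (\<Sum>p\<in>K. \<psi> (B_mult n (B_star (g p)) ?u) *\<^sub>C g p) z)"
      by (simp add: linear_on_vecs_sum[OF linz] linear_on_vecs_scaleC[OF linz] closed
          vecs_scaleC scaleC_complex_def)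
    also have "\<dots> = \<psi> (B_mult n (B_star x) (mult_map d n (y \<otimes>\<^sub>t z)))"
      by (simp only: frame_expand[OF u] mm[OF yz] B_mult_assoc)
    finally show "psi2 (BB_mult n (BB_star (frame_comult x)) (y \<otimes>\<^sub>t z)) =
        \<psi> (B_mult n (B_star x) (mult_map d n (y \<otimes>\<^sub>t z)))" .
  qed
qed

text \<open>An element of \<open>B \<otimes> B\<close> is determined by its pairings with the products \<open>g\<^sub>p \<otimes> g\<^sub>q\<close>, which makes the
  adjoint of the multiplication unique.\<close>

lemma BB_expand:
  assumes \<xi>: "\<xi> \<in> BB_carrier d n"
  shows "(\<Sum>p\<in>K. \<Sum>q\<in>K. psi2 (BB_mult n \<xi> (g p \<otimes>\<^sub>t g q)) *\<^sub>C (B_star (g p) \<otimes>\<^sub>t B_star (g q))) = \<xi>"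
proof (rule linear_on_tensors_ext[where h="\<lambda>\<xi>. \<xi>" and f="\<lambda>\<xi>. \<Sum>p\<in>K. \<Sum>q\<in>K.
      psi2 (BB_mult n \<xi> (g p \<otimes>\<^sub>t g q)) *\<^sub>C (B_star (g p) \<otimes>\<^sub>t B_star (g q))",
      OF finite_ixs finite_ixs _ linear_on_vecs_ident _ \<xi>])
  note closed = frame_closed B_star_closed B_mult_closed
  show "linear_on_vecs (ixs d n \<times> ixs d n) (\<lambda>\<xi>. \<Sum>p\<in>K. \<Sum>q\<in>K.
      psi2 (BB_mult n \<xi> (g p \<otimes>\<^sub>t g q)) *\<^sub>C (B_star (g p) \<otimes>\<^sub>t B_star (g q)))"
  proof (intro linear_on_vecs_sum_fun, rule linear_on_vecs_scaleC_fixed)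
    fix p q assume "p \<in> K" "q \<in> K"
    then show "linear_on_vecs (ixs d n \<times> ixs d n) (\<lambda>\<xi>. psi2 (BB_mult n \<xi> (g p \<otimes>\<^sub>t g q)))"
      by (intro linear_on_vecs_compose[where f="\<lambda>\<xi>. BB_mult n \<xi> (g p \<otimes>\<^sub>t g q)",
            OF linear_on_vecs_BB_mult_left linear_on_vecs_tensor_lift]
          BB_mult_closed tensor_in_vecs closed)
  qed
  fix x y assume xy: "x \<in> B_carrier d n" "y \<in> B_carrier d n"
  have "(\<Sum>p\<in>K. \<Sum>q\<in>K. psi2 (BB_mult n (x \<otimes>\<^sub>t y) (g p \<otimes>\<^sub>t g q)) *\<^sub>C (B_star (g p) \<otimes>\<^sub>t B_star (g q))) =
      (\<Sum>p\<in>K. \<Sum>q\<in>K. (\<psi> (B_mult n x (g p)) *\<^sub>C B_star (g p)) \<otimes>\<^sub>t (\<psi> (B_mult n y (g q)) *\<^sub>C B_star (g q)))"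
    by (intro sum.cong) (auto simp: BB_mult_tensor psi2_tensor closed xy tensor_scaleC_left
        tensor_scaleC_right scaleC_scaleC mult.commute)
  also have "\<dots> = (\<Sum>p\<in>K. \<psi> (B_mult n x (g p)) *\<^sub>C B_star (g p)) \<otimes>\<^sub>t
      (\<Sum>q\<in>K. \<psi> (B_mult n y (g q)) *\<^sub>C B_star (g q))"
    by (auto simp: tensor_def fun_eq_iff sum_fun_apply sum_product)
  also have "\<dots> = x \<otimes>\<^sub>t y" by (simp add: frame_expand_star xy)
  finally show "(\<Sum>p\<in>K. \<Sum>q\<in>K. psi2 (BB_mult n (x \<otimes>\<^sub>t y) (g p \<otimes>\<^sub>t g q)) *\<^sub>C
      (B_star (g p) \<otimes>\<^sub>t B_star (g q))) = x \<otimes>\<^sub>t y" .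
qed

lemma comult_eq:
  assumes x: "x \<in> B_carrier d n"
  shows "comult d n \<psi> x = frame_comult x"
  unfolding comult_def
proof (rule the_equality)
  show "frame_comult x \<in> BB_carrier d n \<and>
      (\<forall>\<eta>\<in>BB_carrier d n. BB_inner d n \<psi> (frame_comult x) \<eta> = B_inner n \<psi> x (mult_map d n \<eta>))"
    by (intro conjI ballI frame_comult_closed frame_comult_adjoint x)
  fix \<xi> assume \<xi>: "\<xi> \<in> BB_carrier d n \<and>
      (\<forall>\<eta>\<in>BB_carrier d n. BB_inner d n \<psi> \<xi> \<eta> = B_inner n \<psi> x (mult_map d n \<eta>))"
  have "psi2 (BB_mult n (BB_star \<xi>) (g p \<otimes>\<^sub>t g q)) =
      psi2 (BB_mult n (BB_star (frame_comult x)) (g p \<otimes>\<^sub>t g q))" if "p \<in> K" "q \<in> K" for p q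
  proof -
    have t: "g p \<otimes>\<^sub>t g q \<in> BB_carrier d n"
      by (intro tensor_in_vecs frame_closed that)
    have "BB_inner d n \<psi> \<xi> (g p \<otimes>\<^sub>t g q) = BB_inner d n \<psi> (frame_comult x) (g p \<otimes>\<^sub>t g q)"
      unfolding frame_comult_adjoint[OF x t] by (rule bspec[OF conjunct2[OF \<xi>] t])
    then show ?thesis unfolding BB_inner_def .
  qed
  then have "(\<Sum>p\<in>K. \<Sum>q\<in>K. psi2 (BB_mult n (BB_star \<xi>) (g p \<otimes>\<^sub>t g q)) *\<^sub>C (B_star (g p) \<otimes>\<^sub>t B_star (g q))) =
      (\<Sum>p\<in>K. \<Sum>q\<in>K. psi2 (BB_mult n (BB_star (frame_comult x)) (g p \<otimes>\<^sub>t g q)) *\<^sub>C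
        (B_star (g p) \<otimes>\<^sub>t B_star (g q)))"
    by (intro sum.cong refl) (simp only:)
  then have "BB_star \<xi> = BB_star (frame_comult x)"
    unfolding BB_expand[OF BB_star_closed[OF conjunct1[OF \<xi>]]]
      BB_expand[OF BB_star_closed[OF frame_comult_closed[OF x]]] .
  then show "\<xi> = frame_comult x" by (metis BB_star_star)
qed

end


section \<open>Local quantum Cuntz--Krieger families in a Parseval frame\<close>

text \<open>The symmetry of \<open>A\<close> under the involution is the form in which complete positivity is used.\<close>

locale qck_frame = parseval_frame +
  fixes \<delta> :: real and A :: "elt \<Rightarrow> elt" and S :: "elt \<Rightarrow> 'c::unital_cstar_algebra"
  assumes delta_pos: "0 < \<delta>"
    and A_closed: "x \<in> B_carrier d n \<Longrightarrow> A x \<in> B_carrier d n"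
    and A_linear: "linear_on_vecs (ixs d n) A"
    and A_star: "x \<in> B_carrier d n \<Longrightarrow> A (B_star x) = B_star (A x)"
    and qck: "local_qck_family d n \<delta> \<psi> A S"
begin

abbreviation inv_delta2 :: complex ("\<kappa>") where
  "\<kappa> \<equiv> complex_of_real (1 / \<delta>\<^sup>2)"

lemma S_linear: "linear_on_vecs (ixs d n) S"
  using qck by (simp add: local_qck_family_def)

text \<open>The map \<open>P\<close> of the product formulas. By the lemmas below \<open>\<delta>\<^sup>2 P\<close> is a *-homomorphism on \<open>B\<close>; it takes the place of
  the projections that a classical Cuntz--Krieger family attaches to vertices.\<close>

definition vertex_map :: "elt \<Rightarrow> 'c" where
  "vertex_map x = prod_map d n S (star_map S) (comult d n \<psi> x)"

lemmas closed = frame_closed B_star_closed B_mult_closed A_closed B_one_closed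

lemma vertex_map_eq:
  assumes "x \<in> B_carrier d n"
  shows "vertex_map x = (\<Sum>p\<in>K. S (B_mult n x (g p)) * star (S (g p)))"
proof -
  have "vertex_map x = (\<Sum>p\<in>K. S (B_mult n x (g p)) * star_map S (B_star (g p)))"
    unfolding vertex_map_def prod_map_def comult_eq[OF assms]
    by (rule tensor_lift_sum[OF finite_ixs finite_ixs
          bilinear_prod[OF S_linear linear_on_vecs_star_map[OF S_linear]]])
      (intro closed assms, assumption)+
  then show ?thesis by (simp add: star_map_def B_star_star)
qed

lemma comult_linear: "linear_on_vecs (ixs d n) (comult d n \<psi>)"
  by (rule linear_on_vecsI)
    (simp_all add: comult_eq vecs_add vecs_scaleC B_mult_add_left B_mult_scaleC_left
      tensor_add_left tensor_scaleC_left sum.distrib scaleC_sum_right)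

lemma comult_closed: "x \<in> B_carrier d n \<Longrightarrow> comult d n \<psi> x \<in> BB_carrier d n"
  by (simp only: comult_eq frame_comult_closed)

lemma vertex_map_linear: "linear_on_vecs (ixs d n) vertex_map"
  unfolding vertex_map_def prod_map_def
  by (rule linear_on_vecs_compose[OF comult_linear linear_on_vecs_tensor_lift comult_closed])

lemma mult_map_tensor:
  assumes "x \<in> B_carrier d n" "y \<in> B_carrier d n"
  shows "mult_map d n (x \<otimes>\<^sub>t y) = B_mult n x y"
  unfolding mult_map_def
  by (rule tensor_lift_bilinear[OF finite_ixs finite_ixs bilinear_on_vecsI[OF
        linear_on_vecs_B_mult_left linear_on_vecs_B_mult_right] assms])

text \<open>The first Cuntz--Krieger relation, evaluated on \<open>x \<otimes> y\<close>.\<close>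

lemma vertex_map_mult_S:
  assumes x: "x \<in> B_carrier d n" and y: "y \<in> B_carrier d n"
  shows "vertex_map x * S y = \<kappa> *\<^sub>C S (B_mult n x y)"
proof -
  have "comult_id d n \<psi> (x \<otimes>\<^sub>t y) = comult d n \<psi> x \<otimes>\<^sub>t y"
    unfolding comult_id_def
    by (rule tensor_lift_bilinear[OF finite_ixs finite_ixs bilinear_on_vecsI[OF
          linear_on_vecs_tensor_left[OF comult_linear]
          linear_on_vecs_tensor_right[OF linear_on_vecs_ident]] x y])
  moreover have "prod_map3 d n S (star_map S) S (comult d n \<psi> x \<otimes>\<^sub>t y) = vertex_map x * S y"
    unfolding prod_map3_def vertex_map_def
  proof (rule tensor_lift_bilinear[OF _ finite_ixs bilinear_on_vecsI comult_closed[OF x] y])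
    show "finite (ixs d n \<times> ixs d n)" by (simp add: finite_ixs)
    show "linear_on_vecs (ixs d n \<times> ixs d n) (\<lambda>\<xi>. prod_map d n S (star_map S) \<xi> * S z)" for z
      unfolding prod_map_def by (rule linear_on_vecs_mult_right[OF linear_on_vecs_tensor_lift])
    show "linear_on_vecs (ixs d n) (\<lambda>z. prod_map d n S (star_map S) \<xi> * S z)" for \<xi>
      by (rule linear_on_vecs_mult_left[OF S_linear])
  qed
  moreover have "prod_map3 d n S (star_map S) S (comult_id d n \<psi> (x \<otimes>\<^sub>t y)) =
      \<kappa> *\<^sub>C S (mult_map d n (x \<otimes>\<^sub>t y))"
    using qck tensor_in_vecs[OF x y] unfolding local_qck_family_def by blast
  ultimately show ?thesis by (simp only: mult_map_tensor[OF x y])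
qed

text \<open>The second Cuntz--Krieger relation, evaluated on \<open>x\<^sup>* \<otimes> y\<close>.\<close>

lemma star_S_mult_S:
  assumes x: "x \<in> B_carrier d n" and y: "y \<in> B_carrier d n"
  shows "star (S x) * S y = \<kappa> *\<^sub>C vertex_map (A (B_mult n (B_star x) y))"
proof -
  have "prod_map d n (star_map S) S (B_star x \<otimes>\<^sub>t y) = star_map S (B_star x) * S y"
    unfolding prod_map_def
    by (rule tensor_lift_bilinear[OF finite_ixs finite_ixs
          bilinear_prod[OF linear_on_vecs_star_map[OF S_linear] S_linear] B_star_closed[OF x] y])
  moreover have "prod_map d n (star_map S) S (B_star x \<otimes>\<^sub>t y) =
      \<kappa> *\<^sub>C vertex_map (A (mult_map d n (B_star x \<otimes>\<^sub>t y)))"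
    using qck tensor_in_vecs[OF B_star_closed[OF x] y]
    unfolding local_qck_family_def vertex_map_def by blast
  ultimately show ?thesis
    by (simp only: mult_map_tensor[OF B_star_closed[OF x] y] star_map_def B_star_star)
qed

lemma vertex_map_mult:
  assumes x: "x \<in> B_carrier d n" and y: "y \<in> B_carrier d n"
  shows "vertex_map x * vertex_map y = \<kappa> *\<^sub>C vertex_map (B_mult n x y)"
proof -
  have "vertex_map x * vertex_map y = (\<Sum>p\<in>K. (vertex_map x * S (B_mult n y (g p))) * star (S (g p)))"
    by (simp only: vertex_map_eq[OF y] sum_distrib_left mult.assoc)
  also have "\<dots> = \<kappa> *\<^sub>C vertex_map (B_mult n x y)"
    by (simp add: vertex_map_mult_S closed x y vertex_map_eq[OF B_mult_closed[OF x y]]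
        scaleC_sum_right scaleC_mult_left B_mult_assoc)
  finally show ?thesis .
qed

text \<open>The involution exchanges the two ways \<open>\<Sum>\<^sub>p x\<^sup>* g\<^sub>p \<otimes> g\<^sub>p\<^sup>*\<close> and \<open>\<Sum>\<^sub>p g\<^sub>p \<otimes> g\<^sub>p\<^sup>* x\<^sup>*\<close> of writing \<open>m\<^sup>*(x\<^sup>*)\<close>.\<close>

lemma star_vertex_map:
  assumes x: "x \<in> B_carrier d n"
  shows "star (vertex_map x) = vertex_map (B_star x)"
proof -
  have "vertex_map (B_star x) = (\<Sum>p\<in>K. S (B_mult n (B_star x) (g p)) * star_map S (B_star (g p)))"
    by (simp add: vertex_map_eq closed x star_map_def B_star_star)
  also have "\<dots> = (\<Sum>p\<in>K. S (g p) * star_map S (B_mult n (B_star (g p)) (B_star x)))"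
    by (rule frame_bimodule[OF bilinear_prod[OF S_linear linear_on_vecs_star_map[OF S_linear]]
          B_star_closed[OF x]])
  also have "\<dots> = star (vertex_map x)"
    by (simp add: vertex_map_eq x star_sum star_mult star_star star_map_def B_star_mult B_star_star)
  finally show ?thesis ..
qed

text \<open>Since \<open>\<delta>\<^sup>2 P(1)\<close> acts as a left unit on the range of \<open>S\<close>, expand \<open>P(1) = \<Sum>\<^sub>p S(g\<^sub>p) S(g\<^sub>p)\<^sup>*\<close> in \<open>\<delta>\<^sup>2 P(1) S(x)\<close> and rewrite
  each \<open>S(g\<^sub>p)\<^sup>* S(x)\<close>.\<close>

lemma S_expand:
  assumes x: "x \<in> B_carrier d n"
  shows "S x = (\<Sum>p\<in>K. S (g p) * vertex_map (A (B_mult n (B_star (g p)) x)))"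
proof -
  have \<kappa>: "complex_of_real (\<delta>\<^sup>2) * \<kappa> = 1"
    using delta_pos by (simp flip: of_real_mult)
  have "S x = complex_of_real (\<delta>\<^sup>2) *\<^sub>C (\<kappa> *\<^sub>C S x)"
    unfolding scaleC_scaleC \<kappa> scaleC_one ..
  also have "\<kappa> *\<^sub>C S x = vertex_map (B_one d n) * S x"
    by (simp only: vertex_map_mult_S[OF B_one_closed x] B_one_mult[OF x])
  also have "\<dots> = (\<Sum>p\<in>K. S (g p) * (star (S (g p)) * S x))"
    by (simp add: vertex_map_eq closed B_one_mult sum_distrib_right mult.assoc)
  also have "\<dots> = \<kappa> *\<^sub>C (\<Sum>p\<in>K. S (g p) * vertex_map (A (B_mult n (B_star (g p)) x)))"
    by (simp add: star_S_mult_S closed x scaleC_mult_right scaleC_sum_right)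
  finally show ?thesis unfolding scaleC_scaleC \<kappa> scaleC_one .
qed

lemma bimodule_action_edge_checker:
  assumes x: "x \<in> B_carrier d n" and y: "y \<in> B_carrier d n"
  shows "bimodule_action d n x (edge_checker d n \<delta> \<psi> A) y =
    \<kappa> *\<^sub>C (\<Sum>p\<in>K. B_mult n x (g p) \<otimes>\<^sub>t B_mult n (A (B_star (g p))) y)"
proof -
  have "comult d n \<psi> (B_one d n) = (\<Sum>p\<in>K. g p \<otimes>\<^sub>t B_star (g p))"
    by (simp add: comult_eq closed B_one_mult)
  then have edge: "edge_checker d n \<delta> \<psi> A = \<kappa> *\<^sub>C (\<Sum>p\<in>K. g p \<otimes>\<^sub>t A (B_star (g p)))"
    unfolding edge_checker_def tensor_map_def
    by (simp add: tensor_lift_sum[OF finite_ixs finite_ixs bilinear_on_vecsI[OF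
            linear_on_vecs_tensor_left[OF linear_on_vecs_ident]
            linear_on_vecs_tensor_right[OF A_linear]]] closed)
  have "(\<Sum>p\<in>K. g p \<otimes>\<^sub>t A (B_star (g p))) \<in> BB_carrier d n"
    by (intro vecs_sum tensor_in_vecs closed)
  then show ?thesis
    unfolding edge bimodule_action_def
    by (simp add: linear_on_vecs_scaleC[OF linear_on_vecs_tensor_lift]
        tensor_lift_sum[OF finite_ixs finite_ixs bilinear_on_vecsI[OF
            linear_on_vecs_tensor_left[OF linear_on_vecs_B_mult_right]
            linear_on_vecs_tensor_right[OF linear_on_vecs_B_mult_left]]] closed)
qed

text \<open>The bimodule property moves \<open>x\<close> from the first tensor factor, where it acts on the edge checker, into the
  argument of \<open>A\<close>, where it occurs in the expansion of \<open>S x\<close>. The map \<open>T\<close> will be \<open>S\<close> or \<open>P\<close>.\<close>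

lemma prod_map_edge_checker:
  assumes x: "x \<in> B_carrier d n" and y: "y \<in> B_carrier d n" and T: "linear_on_vecs (ixs d n) T"
  shows "prod_map d n S T (bimodule_action d n x (edge_checker d n \<delta> \<psi> A) y) =
    \<kappa> *\<^sub>C (\<Sum>p\<in>K. S (g p) * T (B_mult n (A (B_mult n (B_star (g p)) x)) y))"
proof -
  have "(\<Sum>p\<in>K. B_mult n x (g p) \<otimes>\<^sub>t B_mult n (A (B_star (g p))) y) \<in> BB_carrier d n"
    by (intro vecs_sum tensor_in_vecs closed x y)
  then have "prod_map d n S T (bimodule_action d n x (edge_checker d n \<delta> \<psi> A) y) =
      \<kappa> *\<^sub>C (\<Sum>p\<in>K. S (B_mult n x (g p)) * T (B_mult n (A (B_star (g p))) y))"
    unfolding prod_map_def bimodule_action_edge_checker[OF x y]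
    by (simp add: linear_on_vecs_scaleC[OF linear_on_vecs_tensor_lift]
        tensor_lift_sum[OF finite_ixs finite_ixs bilinear_prod[OF S_linear T]] closed x y)
  also have "(\<Sum>p\<in>K. S (B_mult n x (g p)) * T (B_mult n (A (B_star (g p))) y)) =
      (\<Sum>p\<in>K. S (g p) * T (B_mult n (A (B_mult n (B_star (g p)) x)) y))"
  proof (rule frame_bimodule[OF bilinear_prod[OF S_linear] x])
    show "linear_on_vecs (ixs d n) (\<lambda>v. T (B_mult n (A v) y))"
      by (rule linear_on_vecs_compose[OF A_linear
            linear_on_vecs_compose[OF linear_on_vecs_B_mult_left T] A_closed])
        (intro closed y)
  qed
  finally show ?thesis .
qed

lemma S_mult_S:
  assumes x: "x \<in> B_carrier d n" and y: "y \<in> B_carrier d n"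
  shows "S x * S y = prod_map d n S S (bimodule_action d n x (edge_checker d n \<delta> \<psi> A) y)"
  unfolding prod_map_edge_checker[OF x y S_linear]
  by (subst S_expand[OF x])
    (simp add: sum_distrib_right mult.assoc vertex_map_mult_S closed x y scaleC_mult_right
      scaleC_sum_right)

lemma S_mult_star_S:
  assumes x: "x \<in> B_carrier d n" and y: "y \<in> B_carrier d n"
  shows "S x * star (S y) = (\<Sum>q\<in>K. prod_map d n S vertex_map (bimodule_action d n x
    (edge_checker d n \<delta> \<psi> A) (A (B_mult n (B_star y) (g q)))) * star (S (g q)))"
proof -
  have "star (S y) = (\<Sum>q\<in>K. vertex_map (A (B_mult n (B_star y) (g q))) * star (S (g q)))"
    by (subst S_expand[OF y])
      (simp add: star_sum star_mult star_vertex_map closed y B_star_mult B_star_star flip: A_star)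
  then have "S x * star (S y) = (\<Sum>q\<in>K. (S x * vertex_map (A (B_mult n (B_star y) (g q)))) * star (S (g q)))"
    by (simp add: sum_distrib_left mult.assoc)
  also have "\<dots> = (\<Sum>q\<in>K. prod_map d n S vertex_map (bimodule_action d n x
    (edge_checker d n \<delta> \<psi> A) (A (B_mult n (B_star y) (g q)))) * star (S (g q)))"
  proof (intro sum.cong refl)
    fix q assume "q \<in> K"
    then have z: "A (B_mult n (B_star y) (g q)) \<in> B_carrier d n" by (intro closed y)
    have "S x * vertex_map (A (B_mult n (B_star y) (g q))) = prod_map d n S vertex_map
        (bimodule_action d n x (edge_checker d n \<delta> \<psi> A) (A (B_mult n (B_star y) (g q))))"
      unfolding prod_map_edge_checker[OF x z vertex_map_linear]
      by (subst S_expand[OF x])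
        (simp add: sum_distrib_right mult.assoc vertex_map_mult closed x z scaleC_mult_right
          scaleC_sum_right)
    then show "S x * vertex_map (A (B_mult n (B_star y) (g q))) * star (S (g q)) =
        prod_map d n S vertex_map (bimodule_action d n x
          (edge_checker d n \<delta> \<psi> A) (A (B_mult n (B_star y) (g q)))) * star (S (g q))"
      by (simp only:)
  qed
  finally show ?thesis .
qed

end


section \<open>Matrix units diagonalising the density\<close>

definition B_trace :: "nat \<Rightarrow> (nat \<Rightarrow> nat) \<Rightarrow> elt \<Rightarrow> complex" where
  "B_trace d n x = (\<Sum>a\<in>{1..d}. block_trace n a x)"

lemma linear_on_vecs_B_trace: "linear_on_vecs I (B_trace d n)"
  by (rule linear_on_vecsI)
    (simp_all add: B_trace_def block_trace_def sum.distrib scaleC_fun_def scaleC_complex_def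
      sum_distrib_left)

lemma B_trace_commute: "B_trace d n (B_mult n x y) = B_trace d n (B_mult n y x)"
  unfolding B_trace_def block_trace_def B_mult_def prod.case
  by (rule sum.cong[OF refl], subst sum.swap) (simp add: mult.commute)

lemma B_trace_star_mult_eq_0:
  assumes x: "x \<in> B_carrier d n" and 0: "B_trace d n (B_mult n (B_star x) x) = 0"
  shows "x = 0"
proof -
  have "complex_of_real (\<Sum>a\<in>{1..d}. \<Sum>i\<in>{1..n a}. \<Sum>k\<in>{1..n a}. (cmod (x (a, k, i)))\<^sup>2) =
      B_trace d n (B_mult n (B_star x) x)"
    unfolding B_trace_def block_trace_def B_mult_def B_star_def prod.case of_real_sum
    by (intro sum.cong refl) (metis complex_norm_square mult.commute of_real_power)
  then have z: "(\<Sum>a\<in>{1..d}. \<Sum>i\<in>{1..n a}. \<Sum>k\<in>{1..n a}. (cmod (x (a, k, i)))\<^sup>2) = 0"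
    unfolding 0 by (simp only: of_real_eq_0_iff)
  have "x (a, k, i) = 0" if "(a, k, i) \<in> ixs d n" for a k i
    using z that by (auto simp: sum_nonneg_eq_0_iff sum_nonneg ixs_def)
  then show ?thesis
    using x by (fastforce simp: vecs_def fun_eq_iff)
qed

locale diagonalising_units =
  fixes d :: nat and n :: "nat \<Rightarrow> nat" and \<delta> :: real and \<psi> :: "elt \<Rightarrow> complex" and \<rho> :: elt
    and e :: "nat \<Rightarrow> nat \<Rightarrow> nat \<Rightarrow> elt"
  assumes delta_form: "delta_form d n \<delta> \<psi>" and density: "density_matrix d n \<psi> \<rho>"
    and units: "matrix_units d n e" and diagonal: "diagonal_wrt d n e \<rho>"
begin

lemma state_linear: "linear_on_vecs (ixs d n) \<psi>"
  using delta_form by (simp add: delta_form_def B_state_def)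

lemma unit_closed: "(a, i, j) \<in> ixs d n \<Longrightarrow> e a i j \<in> B_carrier d n"
  and unit_block: "(a, i, j) \<in> ixs d n \<Longrightarrow> b \<noteq> a \<Longrightarrow> e a i j (b, k, l) = 0"
  and unit_star: "(a, i, j) \<in> ixs d n \<Longrightarrow> B_star (e a i j) = e a j i"
  using units unfolding matrix_units_def vecs_def by fastforce+

lemma unit_mult:
  assumes "(a, i, j) \<in> ixs d n" "(b, k, l) \<in> ixs d n"
  shows "B_mult n (e a i j) (e b k l) = (if a = b \<and> j = k then e a i l else 0)"
  using units assms unfolding matrix_units_def by fast

lemma linear_ext_units:
  fixes f h :: "elt \<Rightarrow> 'v::complex_vector_space"
  assumes f: "linear_on_vecs (ixs d n) f" and h: "linear_on_vecs (ixs d n) h"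
    and eq: "\<And>a i j. (a, i, j) \<in> ixs d n \<Longrightarrow> f (e a i j) = h (e a i j)"
    and x: "x \<in> B_carrier d n"
  shows "f x = h x"
proof -
  obtain c where x_eq: "x = (\<Sum>(a, i, j)\<in>ixs d n. c a i j *\<^sub>C e a i j)"
    using units x unfolding matrix_units_def by blast
  have expand: "u x = (\<Sum>(a, i, j)\<in>ixs d n. c a i j *\<^sub>C u (e a i j))"
    if u: "linear_on_vecs (ixs d n) u" for u :: "elt \<Rightarrow> 'v"
    unfolding x_eq
    by (subst linear_on_vecs_sum[OF u])
      (auto intro!: vecs_scaleC unit_closed sum.cong linear_on_vecs_scaleC[OF u])
  show ?thesis
    unfolding expand[OF f] expand[OF h] by (intro sum.cong refl) (auto simp: eq)
qed

text \<open>If one diagonal unit vanishes then all units of its block do, since \<open>e\<^sub>j\<^sub>k = e\<^sub>j\<^sub>i e\<^sub>i\<^sub>i e\<^sub>i\<^sub>k\<close>, and the units no longer span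
  the unit of \<open>B\<close>.\<close>

lemma unit_nonzero:
  assumes ii: "(a, i, i) \<in> ixs d n"
  shows "e a i i \<noteq> 0"
proof
  assume 0: "e a i i = 0"
  have block: "e a j k = 0" if "(a, j, k) \<in> ixs d n" for j k
  proof -
    have ji: "(a, j, i) \<in> ixs d n" and ik: "(a, i, k) \<in> ixs d n"
      using ii that by (auto simp: ixs_def)
    have "e a j k = B_mult n (B_mult n (e a j i) (e a i i)) (e a i k)"
      by (simp add: unit_mult ji ik ii)
    then show ?thesis by (simp add: 0 B_mult_zero_left B_mult_zero_right)
  qed
  obtain c where "B_one d n = (\<Sum>(b, j, k)\<in>ixs d n. c b j k *\<^sub>C e b j k)"
    using units B_one_closed[of d n] unfolding matrix_units_def by blast
  then have "B_one d n (a, i, i) = (\<Sum>(b, j, k)\<in>ixs d n. c b j k * e b j k (a, i, i))"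
    by (simp add: sum_fun_apply case_prod_beta scaleC_fun_def scaleC_complex_def)
  also have "\<dots> = 0"
  proof (intro sum.neutral ballI, clarify)
    fix b j k assume bjk: "(b, j, k) \<in> ixs d n"
    show "c b j k * e b j k (a, i, i) = 0"
      by (cases "b = a") (use bjk block unit_block in auto)
  qed
  finally show False using ii by (simp add: B_one_def)
qed

lemma trace_unit_diag:
  assumes ii: "(a, i, i) \<in> ixs d n"
  shows "B_trace d n (e a i i) \<noteq> 0"
  using B_trace_star_mult_eq_0[OF unit_closed[OF ii]] unit_nonzero[OF ii]
  by (auto simp: unit_star unit_mult ii)

lemma trace_unit_offdiag:
  assumes ij: "(a, i, j) \<in> ixs d n" and "i \<noteq> j"
  shows "B_trace d n (e a i j) = 0"
proof -
  have ii: "(a, i, i) \<in> ixs d n" using ij by (auto simp: ixs_def)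
  have "B_trace d n (e a i j) = B_trace d n (B_mult n (e a i i) (e a i j))"
    by (simp add: unit_mult ii ij)
  also have "\<dots> = B_trace d n (B_mult n (e a i j) (e a i i))" by (rule B_trace_commute)
  also have "\<dots> = 0"
    using \<open>i \<noteq> j\<close> linear_on_vecs_zero[OF linear_on_vecs_B_trace] by (simp add: unit_mult ii ij)
  finally show ?thesis .
qed

lemma state_eq_trace: "x \<in> B_carrier d n \<Longrightarrow> \<psi> x = B_trace d n (B_mult n \<rho> x)"
  using density by (simp add: density_matrix_def B_trace_def)

lemma density_mult_unit:
  obtains r where "\<And>a i j. (a, i, j) \<in> ixs d n \<Longrightarrow> B_mult n \<rho> (e a i j) = r a i *\<^sub>C e a i j"
    and "\<And>a i. (a, i, i) \<in> ixs d n \<Longrightarrow> B_mult n (e a i i) \<rho> = r a i *\<^sub>C e a i i"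
proof -
  obtain r where \<rho>: "\<rho> = (\<Sum>b\<in>{1..d}. \<Sum>k\<in>{1..n b}. r b k *\<^sub>C e b k k)"
    using diagonal unfolding diagonal_wrt_def by blast
  note lin = linear_on_vecs_sum[where I=UNIV, OF linear_on_vecs_B_mult_left]
    linear_on_vecs_sum[where I=UNIV, OF linear_on_vecs_B_mult_right]
  have in_ixs: "(b, k, k) \<in> ixs d n" if "b \<in> {1..d}" "k \<in> {1..n b}" for b k
    using that by (auto simp: ixs_def)
  show ?thesis
  proof
    fix a i j assume ij: "(a, i, j) \<in> ixs d n"
    then have ai: "a \<in> {1..d}" "i \<in> {1..n a}" by (auto simp: ixs_def)
    have "B_mult n \<rho> (e a i j) = (\<Sum>b\<in>{1..d}. \<Sum>k\<in>{1..n b}. B_mult n (r b k *\<^sub>C e b k k) (e a i j))"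
      unfolding \<rho> by (simp add: lin vecs_def)
    also have "\<dots> = (\<Sum>b\<in>{1..d}. if b = a then \<Sum>k\<in>{1..n a}. if k = i then r a i *\<^sub>C e a i j else 0 else 0)"
    proof (intro sum.cong refl)
      fix b assume b: "b \<in> {1..d}"
      have "B_mult n (r b k *\<^sub>C e b k k) (e a i j) =
          (if b = a then if k = i then r a i *\<^sub>C e a i j else 0 else 0)" if "k \<in> {1..n b}" for k
        using that b by (simp add: B_mult_scaleC_left unit_mult[OF in_ixs ij] scaleC_zero_right)
      then show "(\<Sum>k\<in>{1..n b}. B_mult n (r b k *\<^sub>C e b k k) (e a i j)) =
          (if b = a then \<Sum>k\<in>{1..n a}. if k = i then r a i *\<^sub>C e a i j else 0 else 0)"
        by (cases "b = a") simp_all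
    qed
    also have "\<dots> = r a i *\<^sub>C e a i j" using ai by simp
    finally show "B_mult n \<rho> (e a i j) = r a i *\<^sub>C e a i j" .
  next
    fix a i assume ii: "(a, i, i) \<in> ixs d n"
    then have ai: "a \<in> {1..d}" "i \<in> {1..n a}" by (auto simp: ixs_def)
    have "B_mult n (e a i i) \<rho> = (\<Sum>b\<in>{1..d}. \<Sum>k\<in>{1..n b}. B_mult n (e a i i) (r b k *\<^sub>C e b k k))"
      unfolding \<rho> by (simp add: lin vecs_def)
    also have "\<dots> = (\<Sum>b\<in>{1..d}. if b = a then \<Sum>k\<in>{1..n a}. if k = i then r a i *\<^sub>C e a i i else 0 else 0)"
    proof (intro sum.cong refl)
      fix b assume b: "b \<in> {1..d}"
      have "B_mult n (e a i i) (r b k *\<^sub>C e b k k) =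
          (if b = a then if k = i then r a i *\<^sub>C e a i i else 0 else 0)" if "k \<in> {1..n b}" for k
        using that b by (simp add: B_mult_scaleC_right unit_mult[OF ii in_ixs] scaleC_zero_right)
      then show "(\<Sum>k\<in>{1..n b}. B_mult n (e a i i) (r b k *\<^sub>C e b k k)) =
          (if b = a then \<Sum>k\<in>{1..n a}. if k = i then r a i *\<^sub>C e a i i else 0 else 0)"
        by (cases "b = a") simp_all
    qed
    also have "\<dots> = r a i *\<^sub>C e a i i" using ai by simp
    finally show "B_mult n (e a i i) \<rho> = r a i *\<^sub>C e a i i" .
  qed
qed

abbreviation weight :: "nat \<Rightarrow> nat \<Rightarrow> real" where
  "weight a i \<equiv> Re (\<psi> (e a i i))"

lemma state_unit_offdiag:
  assumes ij: "(a, i, j) \<in> ixs d n" and "i \<noteq> j"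
  shows "\<psi> (e a i j) = 0"
proof -
  obtain r where "B_mult n \<rho> (e a i j) = r a i *\<^sub>C e a i j"
    using density_mult_unit ij by metis
  then show ?thesis
    using trace_unit_offdiag[OF assms]
    by (simp add: state_eq_trace unit_closed ij scaleC_complex_def
        linear_on_vecs_scaleC[OF linear_on_vecs_B_trace unit_closed[OF ij]])
qed

text \<open>Let \<open>r\<close> be the eigenvalue of \<open>\<rho>\<close> on \<open>e\<^sub>i\<^sub>i\<close>, so \<open>\<psi>(e\<^sub>i\<^sub>i) = r Tr(e\<^sub>i\<^sub>i)\<close>. The \<open>\<delta>\<close>-form provides an invertible density \<open>\<rho>'\<close> of
  \<open>\<psi>\<close>, with inverse \<open>\<sigma>\<close>. Evaluating \<open>\<psi>(\<sigma> e\<^sub>i\<^sub>i)\<close> with \<open>\<rho>'\<close> gives \<open>Tr(e\<^sub>i\<^sub>i)\<close>, which is not zero, and evaluating it with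
  \<open>\<rho>\<close> gives \<open>r Tr(e\<^sub>i\<^sub>i \<sigma>)\<close>. Hence \<open>r\<close> is not zero.\<close>

lemma state_unit_nonzero:
  assumes ii: "(a, i, i) \<in> ixs d n"
  shows "\<psi> (e a i i) \<noteq> 0"
proof -
  obtain r where r: "B_mult n \<rho> (e a i i) = r a i *\<^sub>C e a i i" "B_mult n (e a i i) \<rho> = r a i *\<^sub>C e a i i"
    using density_mult_unit ii by metis
  obtain \<rho>' \<sigma> where \<rho>': "density_matrix d n \<psi> \<rho>'" "\<sigma> \<in> B_carrier d n" "B_mult n \<rho>' \<sigma> = B_one d n"
    using delta_form unfolding delta_form_def by blast
  note ec = unit_closed[OF ii]
  have se: "B_mult n \<sigma> (e a i i) \<in> B_carrier d n" by (rule B_mult_closed[OF \<rho>'(2) ec])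
  have "B_trace d n (e a i i) = B_trace d n (B_mult n \<rho>' (B_mult n \<sigma> (e a i i)))"
    by (simp add: \<rho>'(3) B_one_mult[OF ec] flip: B_mult_assoc)
  also have "\<dots> = \<psi> (B_mult n \<sigma> (e a i i))"
    using \<rho>'(1) se by (simp add: density_matrix_def B_trace_def)
  also have "\<dots> = B_trace d n (B_mult n \<rho> (B_mult n \<sigma> (e a i i)))" by (rule state_eq_trace[OF se])
  also have "\<dots> = B_trace d n (B_mult n (B_mult n (e a i i) \<rho>) \<sigma>)"
    unfolding B_mult_assoc[of n "e a i i"]
    by (simp only: B_trace_commute[of d n "e a i i"] B_mult_assoc)
  also have "\<dots> = r a i * B_trace d n (B_mult n (e a i i) \<sigma>)"
    by (simp add: r B_mult_scaleC_left scaleC_complex_def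
        linear_on_vecs_scaleC[OF linear_on_vecs_B_trace B_mult_closed[OF ec \<rho>'(2)]])
  finally have "r a i \<noteq> 0" using trace_unit_diag[OF ii] by auto
  then show ?thesis
    using trace_unit_diag[OF ii] by (simp add: state_eq_trace ec r scaleC_complex_def
        linear_on_vecs_scaleC[OF linear_on_vecs_B_trace ec])
qed

lemma state_unit_diag:
  assumes ii: "(a, i, i) \<in> ixs d n"
  shows "\<psi> (e a i i) = complex_of_real (weight a i)" and "0 < weight a i"
proof -
  have "\<psi> (B_mult n (B_star (e a i i)) (e a i i)) \<in> \<real> \<and>
      0 \<le> Re (\<psi> (B_mult n (B_star (e a i i)) (e a i i)))"
    using delta_form unit_closed[OF ii] unfolding delta_form_def B_state_def by blast
  then have re: "\<psi> (e a i i) \<in> \<real>" "0 \<le> weight a i" by (simp_all add: unit_star unit_mult ii)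
  then show "\<psi> (e a i i) = complex_of_real (weight a i)" by (simp add: of_real_Re)
  then show "0 < weight a i"
    using re(2) state_unit_nonzero[OF ii] by (metis less_eq_real_def of_real_0)
qed

text \<open>Only the column weight is used: \<open>\<psi>(e\<^sub>r\<^sub>s\<^sup>* e\<^sub>r\<^sub>s) = \<psi>(e\<^sub>s\<^sub>s)\<close>, so this normalisation gives vectors of
  length one, in contrast to the adapted units, which carry both weights.\<close>

definition unit_basis :: "ix \<Rightarrow> elt" where
  "unit_basis = (\<lambda>(a, i, j). complex_of_real (1 / sqrt (weight a j)) *\<^sub>C e a i j)"

lemma unit_basis_closed: "p \<in> ixs d n \<Longrightarrow> unit_basis p \<in> B_carrier d n"
  by (cases p) (auto simp: unit_basis_def intro: vecs_scaleC unit_closed)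

lemma weight_cancel:
  assumes "(a, i, i) \<in> ixs d n"
  shows "complex_of_real (1 / sqrt (weight a i)) * \<psi> (e a i i) * complex_of_real (1 / sqrt (weight a i)) = 1"
proof -
  define w where "w = weight a i"
  have "\<psi> (e a i i) = complex_of_real w" "0 < w"
    using state_unit_diag[OF assms] by (simp_all add: w_def)
  moreover have "1 / sqrt w * w * (1 / sqrt w) = 1" if "0 < w"
    using that by (simp add: field_simps)
  ultimately show ?thesis
    by (metis of_real_1 of_real_mult w_def)
qed

lemma parseval_frame_units: "parseval_frame d n \<psi> (ixs d n) unit_basis"
proof
  show "linear_on_vecs (ixs d n) \<psi>" by (rule state_linear)
  show "unit_basis p \<in> B_carrier d n" if "p \<in> ixs d n" for p by (rule unit_basis_closed[OF that])
next
  fix x assume x: "x \<in> B_carrier d n"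
  show "(\<Sum>p\<in>ixs d n. \<psi> (B_mult n (B_star (unit_basis p)) x) *\<^sub>C unit_basis p) = x"
  proof (rule linear_ext_units[OF _ linear_on_vecs_ident _ x, where
        f="\<lambda>x. \<Sum>p\<in>ixs d n. \<psi> (B_mult n (B_star (unit_basis p)) x) *\<^sub>C unit_basis p"])
    show "linear_on_vecs (ixs d n) (\<lambda>x. \<Sum>p\<in>ixs d n. \<psi> (B_mult n (B_star (unit_basis p)) x) *\<^sub>C unit_basis p)"
    proof (rule linear_on_vecs_sum_fun, rule linear_on_vecs_scaleC_fixed)
      fix p assume "p \<in> ixs d n"
      then show "linear_on_vecs (ixs d n) (\<lambda>x. \<psi> (B_mult n (B_star (unit_basis p)) x))"
        by (intro linear_on_vecs_compose[OF linear_on_vecs_B_mult_right state_linear]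
            B_mult_closed B_star_closed unit_basis_closed)
    qed
    fix a i j assume ij: "(a, i, j) \<in> ixs d n"
    then have jj: "(a, j, j) \<in> ixs d n" by (auto simp: ixs_def)
    have "\<psi> (B_mult n (B_star (unit_basis p)) (e a i j)) *\<^sub>C unit_basis p =
        (if p = (a, i, j) then e a i j else 0)" if p: "p \<in> ixs d n" for p
    proof -
      obtain b r s where p_eq: "p = (b, r, s)" by (cases p)
      have rs: "(b, r, s) \<in> ixs d n" and sr: "(b, s, r) \<in> ixs d n"
        using p by (auto simp: p_eq ixs_def)
      have sj: "(a, s, j) \<in> ixs d n" if "b = a"
        using rs ij that by (auto simp: ixs_def)
      have "\<psi> (B_mult n (B_star (unit_basis p)) (e a i j)) =
          (if b = a \<and> r = i then complex_of_real (1 / sqrt (weight b s)) * \<psi> (e a s j) else 0)"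
        using sj linear_on_vecs_zero[OF state_linear]
        by (auto simp: p_eq unit_basis_def B_star_scaleC unit_star[OF rs] B_mult_scaleC_left
            unit_mult[OF sr ij] scaleC_zero_right scaleC_complex_def
            linear_on_vecs_scaleC[OF state_linear] unit_closed)
      then show ?thesis
        using sj state_unit_offdiag[of a s j] weight_cancel[OF jj]
        by (cases "s = j") (auto simp: p_eq unit_basis_def scaleC_scaleC scaleC_zero_left scaleC_one)
    qed
    then show "(\<Sum>p\<in>ixs d n. \<psi> (B_mult n (B_star (unit_basis p)) (e a i j)) *\<^sub>C unit_basis p) = e a i j"
      using ij by (simp add: finite_ixs)
  qed
next
  fix x assume x: "x \<in> B_carrier d n"
  show "(\<Sum>p\<in>ixs d n. \<psi> (B_mult n x (unit_basis p)) *\<^sub>C B_star (unit_basis p)) = x"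
  proof (rule linear_ext_units[OF _ linear_on_vecs_ident _ x, where
        f="\<lambda>x. \<Sum>p\<in>ixs d n. \<psi> (B_mult n x (unit_basis p)) *\<^sub>C B_star (unit_basis p)"])
    show "linear_on_vecs (ixs d n) (\<lambda>x. \<Sum>p\<in>ixs d n. \<psi> (B_mult n x (unit_basis p)) *\<^sub>C B_star (unit_basis p))"
    proof (rule linear_on_vecs_sum_fun, rule linear_on_vecs_scaleC_fixed)
      fix p assume "p \<in> ixs d n"
      then show "linear_on_vecs (ixs d n) (\<lambda>x. \<psi> (B_mult n x (unit_basis p)))"
        by (intro linear_on_vecs_compose[OF linear_on_vecs_B_mult_left state_linear]
            B_mult_closed unit_basis_closed)
    qed
    fix a i j assume ij: "(a, i, j) \<in> ixs d n"
    then have ii: "(a, i, i) \<in> ixs d n" and ji: "(a, j, i) \<in> ixs d n" by (auto simp: ixs_def)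
    have "\<psi> (B_mult n (e a i j) (unit_basis p)) *\<^sub>C B_star (unit_basis p) =
        (if p = (a, j, i) then e a i j else 0)" if p: "p \<in> ixs d n" for p
    proof -
      obtain b r s where p_eq: "p = (b, r, s)" by (cases p)
      have rs: "(b, r, s) \<in> ixs d n" using p by (simp add: p_eq)
      have i_s: "(a, i, s) \<in> ixs d n" if "b = a"
        using rs ij that by (auto simp: ixs_def)
      have "\<psi> (B_mult n (e a i j) (unit_basis p)) =
          (if b = a \<and> r = j then complex_of_real (1 / sqrt (weight b s)) * \<psi> (e a i s) else 0)"
        using i_s linear_on_vecs_zero[OF state_linear]
        by (auto simp: p_eq unit_basis_def B_mult_scaleC_right
            unit_mult[OF ij rs] scaleC_zero_right scaleC_complex_def
            linear_on_vecs_scaleC[OF state_linear] unit_closed)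
      then show ?thesis
        using i_s state_unit_offdiag[of a i s] weight_cancel[OF ii]
        by (cases "s = i") (auto simp: p_eq unit_basis_def B_star_scaleC unit_star[OF rs] unit_star[OF ji]
            scaleC_scaleC scaleC_zero_left scaleC_one)
    qed
    then show "(\<Sum>p\<in>ixs d n. \<psi> (B_mult n (e a i j) (unit_basis p)) *\<^sub>C B_star (unit_basis p)) = e a i j"
      using ji by (simp add: finite_ixs)
  qed
qed

lemma adapted_unit_closed: "(a, i, j) \<in> ixs d n \<Longrightarrow> adapted_unit \<psi> e a i j \<in> B_carrier d n"
  by (simp add: adapted_unit_def vecs_scaleC unit_closed)

lemma adapted_unit_star:
  "(a, i, j) \<in> ixs d n \<Longrightarrow> B_star (adapted_unit \<psi> e a i j) = adapted_unit \<psi> e a j i"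
  by (simp add: adapted_unit_def B_star_scaleC unit_star mult.commute)

lemma adapted_unit_mult_orthogonal:
  assumes "(a, i, j) \<in> ixs d n" "(b, k, l) \<in> ixs d n" "\<not> (a = b \<and> j = k)"
  shows "B_mult n (adapted_unit \<psi> e a i j) (adapted_unit \<psi> e b k l) = 0"
  using assms by (auto simp: adapted_unit_def B_mult_scaleC_left B_mult_scaleC_right unit_mult
      scaleC_zero_right)

lemma adapted_unit_mult_basis:
  assumes ij: "(a, i, j) \<in> ixs d n" and rs: "(b, r, s) \<in> ixs d n"
  shows "B_mult n (adapted_unit \<psi> e a i j) (unit_basis (b, r, s)) =
    (if a = b \<and> j = r then complex_of_real (1 / sqrt (weight a j)) *\<^sub>C adapted_unit \<psi> e a i s else 0)"
  by (auto simp: adapted_unit_def unit_basis_def B_mult_scaleC_left B_mult_scaleC_right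
      unit_mult[OF ij rs] scaleC_zero_right scaleC_scaleC mult_ac)

end


section \<open>Vanishing products of the generators\<close>

theorem theorem3p1:
  fixes d :: nat and n :: "nat \<Rightarrow> nat" and \<delta> :: real
    and \<psi> :: "elt \<Rightarrow> complex" and \<rho> :: elt
    and A :: "elt \<Rightarrow> elt"
    and e f :: "nat \<Rightarrow> nat \<Rightarrow> nat \<Rightarrow> elt"
    and S :: "elt \<Rightarrow> 'c::unital_cstar_algebra"
    and a b i j k l :: nat
  assumes "1 \<le> d" and "\<And>a. a \<in> {1..d} \<Longrightarrow> 1 \<le> n a"
    and "finite_quantum_graph d n \<delta> \<psi> A"
    and "completely_positive d n A"
    and "density_matrix d n \<psi> \<rho>"
    and "matrix_units d n e" and "diagonal_wrt d n e \<rho>"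
    and "f = adapted_unit \<psi> e"
    and "local_qck_family d n \<delta> \<psi> A S"
    and "a \<in> {1..d}" and "b \<in> {1..d}"
    and "i \<in> {1..n a}" and "j \<in> {1..n a}"
    and "k \<in> {1..n b}" and "l \<in> {1..n b}"
  shows "(star (S (f a i j)) * S (f b k l) \<noteq> 0 \<longrightarrow> a = b \<and> i = k) \<and>
    (S (f a i j) * S (f b k l) \<noteq> 0 \<longrightarrow>
       bimodule_action d n (f a i j) (edge_checker d n \<delta> \<psi> A) (f b k l) \<noteq> 0) \<and>
    (S (f a i j) * star (S (f b k l)) \<noteq> 0 \<longrightarrow>
       (\<exists>q\<in>{1..n b}.
          bimodule_action d n (f a i j) (edge_checker d n \<delta> \<psi> A) (A (f b l q)) \<noteq> 0))"
proof -
  have form: "delta_form d n \<delta> \<psi>" and adj: "quantum_adjacency d n \<delta> \<psi> A"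
    using assms(3) by (simp_all add: finite_quantum_graph_def)
  interpret U: diagonalising_units d n \<delta> \<psi> \<rho> e
    using form assms(5-7) by unfold_locales
  interpret F: parseval_frame d n \<psi> "ixs d n" U.unit_basis
    by (rule U.parseval_frame_units)
  have A_closed: "A x \<in> B_carrier d n" if "x \<in> B_carrier d n" for x
    using adj that unfolding quantum_adjacency_def by blast
  interpret Q: qck_frame d n \<psi> "ixs d n" U.unit_basis \<delta> A S
  proof
    show "0 < \<delta>" using form by (simp add: delta_form_def)
    show "linear_on_vecs (ixs d n) A" using adj by (simp add: quantum_adjacency_def)
    show "A (B_star x) = B_star (A x)" if "x \<in> B_carrier d n" for x
      by (rule completely_positive_star[OF assms(4) that])
  qed (fact A_closed assms(9))+
  have ij: "(a, i, j) \<in> ixs d n" and kl: "(b, k, l) \<in> ixs d n"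
    and ji: "(a, j, i) \<in> ixs d n" and lk: "(b, l, k) \<in> ixs d n"
    using assms(10-15) by (auto simp: ixs_def)
  have x: "f a i j \<in> B_carrier d n" and y: "f b k l \<in> B_carrier d n"
    using ij kl by (simp_all add: assms(8) U.adapted_unit_closed)
  let ?edge = "edge_checker d n \<delta> \<psi> A"
  have lift_zero: "tensor_lift I J \<beta> 0 = 0" for I J :: "ix set" and \<beta> :: "elt \<Rightarrow> elt \<Rightarrow> 'v::complex_vector_space"
    by (rule linear_on_vecs_zero[OF linear_on_vecs_tensor_lift])
  show ?thesis
  proof (intro conjI impI)
    assume nz: "star (S (f a i j)) * S (f b k l) \<noteq> 0"
    have "a = b \<and> i = k"
    proof (rule ccontr)
      assume "\<not> (a = b \<and> i = k)"
      then have "B_mult n (B_star (f a i j)) (f b k l) = 0"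
        by (simp add: assms(8) U.adapted_unit_star ij U.adapted_unit_mult_orthogonal ji kl)
      then have "star (S (f a i j)) * S (f b k l) = 0"
        by (simp add: Q.star_S_mult_S x y linear_on_vecs_zero[OF Q.A_linear]
            linear_on_vecs_zero[OF Q.vertex_map_linear] scaleC_zero_right)
      then show False using nz by simp
    qed
    then show "a = b" "i = k" by simp_all
  next
    assume "S (f a i j) * S (f b k l) \<noteq> 0"
    then show "bimodule_action d n (f a i j) ?edge (f b k l) \<noteq> 0"
      unfolding Q.S_mult_S[OF x y] prod_map_def using lift_zero by metis
  next
    assume nz: "S (f a i j) * star (S (f b k l)) \<noteq> 0"
    show "\<exists>q\<in>{1..n b}. bimodule_action d n (f a i j) ?edge (A (f b l q)) \<noteq> 0"
    proof (rule ccontr)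
      assume "\<not> ?thesis"
      then have vanish: "bimodule_action d n (f a i j) ?edge (A (f b l q)) = 0" if "q \<in> {1..n b}" for q
        using that by blast
      have "bimodule_action d n (f a i j) ?edge (A (B_mult n (B_star (f b k l)) (U.unit_basis p))) = 0"
        if p: "p \<in> ixs d n" for p
      proof -
        obtain c r s where p_eq: "p = (c, r, s)" by (cases p)
        have crs: "(c, r, s) \<in> ixs d n" using p by (simp add: p_eq)
        have action_scaleC: "bimodule_action d n u \<xi> (t *\<^sub>C v) = t *\<^sub>C bimodule_action d n u \<xi> v" for u \<xi> t v
          by (simp add: bimodule_action_def tensor_lift_def B_mult_scaleC_right tensor_scaleC_right
              scaleC_sum_right scaleC_scaleC case_prod_beta mult.commute)
        have action_zero: "bimodule_action d n u \<xi> 0 = 0" for u \<xi>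
          using action_scaleC[of u \<xi> 0 0] by (simp add: scaleC_zero_left)
        show ?thesis
        proof (cases "b = c \<and> k = r")
          case True
          then have s: "s \<in> {1..n b}" and bls: "(b, l, s) \<in> ixs d n"
            using crs lk by (auto simp: ixs_def)
          have "A (B_mult n (B_star (f b k l)) (U.unit_basis p)) =
              complex_of_real (1 / sqrt (U.weight b k)) *\<^sub>C A (f b l s)"
            unfolding p_eq assms(8) U.adapted_unit_star[OF kl] U.adapted_unit_mult_basis[OF lk crs]
              if_P[OF True] by (rule linear_on_vecs_scaleC[OF Q.A_linear U.adapted_unit_closed[OF bls]])
          then show ?thesis by (simp only: action_scaleC vanish[OF s] scaleC_zero_right)
        next
          case False
          then have "B_mult n (B_star (f b k l)) (U.unit_basis p) = 0"
            by (auto simp: p_eq assms(8) U.adapted_unit_star[OF kl] U.adapted_unit_mult_basis[OF lk crs])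
          then show ?thesis by (simp only: linear_on_vecs_zero[OF Q.A_linear] action_zero)
        qed
      qed
      then have "S (f a i j) * star (S (f b k l)) = 0"
        unfolding Q.S_mult_star_S[OF x y] prod_map_def
        by (intro sum.neutral) (simp add: lift_zero)
      then show False using nz by simp
    qed
  qed
qed

end
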